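(* Fix $t\in(0,1]$. Suppose $(X_1,\ldots,X_p)^T\sim N_p((\mu_1,\ldots,\mu_p)^T,\boldsymbol{\Sigma})$ with $\boldsymbol{\Sigma}=(\sigma_{jk})$ having unit variances, i.e. $\sigma_{jj}=1$ for all $j$. Assume weak dependence: there is $\delta>0$ such that $p^{-2}\sum_{j,k=1}^p|\sigma_{jk}|=O(p^{-\delta})$ as $p\to\infty$. Assume also that $\limsup_{p\to\infty} p_0t/(p_1\bar\xi)<1$. Then $$\lim_{p\to\infty}\left[\mathrm{FDP}(t)-\frac{p_0t}{\sum_{j=1}^p E\{\Phi(q_{t/2}\hat\sigma_j+\sqrt n\,\mu_j)+\Phi(q_{t/2}\hat\sigma_j-\sqrt n\,\mu_j)\}}\right]=0\quad\text{almost surely.}$$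
   Context: Setting: the data $\mathbf{X}_i=(X_{i1},\ldots,X_{ip})^T$, $i=1,\ldots,n$ ($n\ge 2$ fixed), are i.i.d. copies of $(X_1,\ldots,X_p)^T$. The limit is $p\to\infty$; the variables $X_1,X_2,\ldots$ form an infinite Gaussian sequence (with means $\mu_j$ and covariances $\sigma_{jk}$ not depending on $p$), of which the first $p$ coordinates are used for each $p$. One tests $H_{0j}:\mu_j=0$ versus $\mu_j\neq 0$ for $j=1,\ldots,p$. Let $\mathcal{H}_0=\{j\le p:\mu_j=0\}$, $\mathcal{H}_1=\{j\le p:\mu_j\ne0\}$, with cardinalities $p_0$, $p_1$ (depending on $p$). Let $\bar X_j=n^{-1}\sum_{i=1}^nX_{ij}$, $\hat\sigma_j^2=(n-1)^{-1}\sum_{i=1}^n(X_{ij}-\bar X_j)^2$, $\hat\sigma_j=\sqrt{\hat\sigma_j^2}$, and $T_j=\sqrt n\,\bar X_j/\hat\sigma_j$. Let $q_{t/2}$ be the $t/2$ quantile of the Student $t$-distribution with $n-1$ degrees of freedom, and $t_j=\mathrm{1}(|T_j|>|q_{t/2}|)$. Put $R(t)=\sum_{j=1}^pt_j$, $V(t)=\sum_{j\in\mathcal{H}_0}t_j$, and $\mathrm{FDP}(t)=V(t)/R(t)$, with the convention $\mathrm{FDP}(t)=0$ if $R(t)=0$. Let $\xi_j=P(|T_j|>|q_{t/2}|)=E(t_j)$ and $\bar\xi=p_1^{-1}\sum_{j\in\mathcal{H}_1}\xi_j$. $\Phi$ is the standard normal cumulative distribution function. *)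

theory Defs
  imports "HOL-Probability.Probability"
begin

(* N_p(mu, S) is the law of mu + A Z, where Z has i.i.d. standard normal entries and A A^T = S.
   S may be singular. Coordinates, here and below, are numbered from 0. *)
definition multivariate_normal ::
  "'a measure \<Rightarrow> nat \<Rightarrow> (nat \<Rightarrow> 'a \<Rightarrow> real) \<Rightarrow> (nat \<Rightarrow> real) \<Rightarrow> (nat \<Rightarrow> nat \<Rightarrow> real) \<Rightarrow> bool"
where
  "multivariate_normal M p Y \<mu> S \<longleftrightarrow>
     (\<forall>j<p. Y j \<in> borel_measurable M) \<and>
     (\<exists>(m::nat) A. (\<forall>j<p. \<forall>k<p. S j k = (\<Sum>l<m. A j l * A k l)) \<and>
        distr M (\<Pi>\<^sub>M j\<in>{..<p}. borel) (\<lambda>\<omega>. \<lambda>j\<in>{..<p}. Y j \<omega>) =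
        distr (\<Pi>\<^sub>M l\<in>{..<m}. std_normal_distribution) (\<Pi>\<^sub>M j\<in>{..<p}. borel)
          (\<lambda>z. \<lambda>j\<in>{..<p}. \<mu> j + (\<Sum>l<m. A j l * z l)))"

definition std_normal_cdf :: "real \<Rightarrow> real" where
  "std_normal_cdf = cdf std_normal_distribution"

definition student_t_density :: "real \<Rightarrow> real \<Rightarrow> real" where
  "student_t_density \<nu> x =
     Gamma ((\<nu> + 1) / 2) / (sqrt (\<nu> * pi) * Gamma (\<nu> / 2)) *
     (1 + x\<^sup>2 / \<nu>) powr (- ((\<nu> + 1) / 2))"

definition student_t_distribution :: "real \<Rightarrow> real measure" where
  "student_t_distribution \<nu> = density lborel (\<lambda>x. ennreal (student_t_density \<nu> x))"

definition quantile :: "real measure \<Rightarrow> real \<Rightarrow> real" where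
  "quantile D u = Inf {x. u \<le> cdf D x}"

definition t_quantile :: "nat \<Rightarrow> real \<Rightarrow> real" where
  "t_quantile n u = quantile (student_t_distribution (real n - 1)) u"

definition sample_mean :: "nat \<Rightarrow> (nat \<Rightarrow> real) \<Rightarrow> real" where
  "sample_mean n x = (\<Sum>i<n. x i) / real n"

definition sample_sd :: "nat \<Rightarrow> (nat \<Rightarrow> real) \<Rightarrow> real" where
  "sample_sd n x = sqrt ((\<Sum>i<n. (x i - sample_mean n x)\<^sup>2) / (real n - 1))"

definition t_stat :: "nat \<Rightarrow> (nat \<Rightarrow> real) \<Rightarrow> real" where
  "t_stat n x = sqrt (real n) * sample_mean n x / sample_sd n x"

definition rejects :: "nat \<Rightarrow> real \<Rightarrow> (nat \<Rightarrow> real) \<Rightarrow> bool" where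
  "rejects n t x \<longleftrightarrow> \<bar>t_stat n x\<bar> > \<bar>t_quantile n (t / 2)\<bar>"

definition nulls :: "(nat \<Rightarrow> real) \<Rightarrow> nat \<Rightarrow> nat set" where
  "nulls \<mu> p = {j. j < p \<and> \<mu> j = 0}"

definition alternatives :: "(nat \<Rightarrow> real) \<Rightarrow> nat \<Rightarrow> nat set" where
  "alternatives \<mu> p = {j. j < p \<and> \<mu> j \<noteq> 0}"

(* In a data matrix x, row i is the i-th observation and column j the j-th variable. *)

definition num_rejections :: "nat \<Rightarrow> real \<Rightarrow> nat \<Rightarrow> (nat \<Rightarrow> nat \<Rightarrow> real) \<Rightarrow> real" where
  "num_rejections n t p x = (\<Sum>j<p. of_bool (rejects n t (\<lambda>i. x i j)))"

definition num_false_rejections ::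
  "nat \<Rightarrow> real \<Rightarrow> (nat \<Rightarrow> real) \<Rightarrow> nat \<Rightarrow> (nat \<Rightarrow> nat \<Rightarrow> real) \<Rightarrow> real"
where
  "num_false_rejections n t \<mu> p x = (\<Sum>j\<in>nulls \<mu> p. of_bool (rejects n t (\<lambda>i. x i j)))"

definition FDP ::
  "nat \<Rightarrow> real \<Rightarrow> (nat \<Rightarrow> real) \<Rightarrow> nat \<Rightarrow> (nat \<Rightarrow> nat \<Rightarrow> real) \<Rightarrow> real"
where
  "FDP n t \<mu> p x =
     (if num_rejections n t p x = 0 then 0
      else num_false_rejections n t \<mu> p x / num_rejections n t p x)"

definition rejection_prob ::
  "'a measure \<Rightarrow> nat \<Rightarrow> real \<Rightarrow> (nat \<Rightarrow> nat \<Rightarrow> 'a \<Rightarrow> real) \<Rightarrow> nat \<Rightarrow> real"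
where
  "rejection_prob M n t X j = measure M {\<omega> \<in> space M. rejects n t (\<lambda>i. X i j \<omega>)}"

definition average_power ::
  "'a measure \<Rightarrow> nat \<Rightarrow> real \<Rightarrow> (nat \<Rightarrow> nat \<Rightarrow> 'a \<Rightarrow> real) \<Rightarrow> (nat \<Rightarrow> real) \<Rightarrow> nat \<Rightarrow> real"
where
  "average_power M n t X \<mu> p =
     (\<Sum>j\<in>alternatives \<mu> p. rejection_prob M n t X j) / real (card (alternatives \<mu> p))"

(* Extended-real division: the ratio is infinite, not 0, when there are nulls but no
   alternatives. *)
definition null_alt_ratio ::
  "'a measure \<Rightarrow> nat \<Rightarrow> real \<Rightarrow> (nat \<Rightarrow> nat \<Rightarrow> 'a \<Rightarrow> real) \<Rightarrow> (nat \<Rightarrow> real) \<Rightarrow> nat \<Rightarrow> ereal"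
where
  "null_alt_ratio M n t X \<mu> p =
     ereal (real (card (nulls \<mu> p)) * t) /
     ereal (real (card (alternatives \<mu> p)) * average_power M n t X \<mu> p)"

end

theory Submission imports Defs begin

text \<open>
Write \<open>\<xi> j\<close> for the probability that the \<open>j\<close>-th hypothesis is rejected, and \<open>V\<close>, \<open>R\<close> for
the numbers of false and of all rejections among the first \<open>p\<close> hypotheses.  The proof combines an
exact computation of the means of \<open>V\<close> and \<open>R\<close> with a strong law of large numbers for both.

The means.  A normal sample can be rotated so that its scaled mean becomes one coordinate and its
sum of squared deviations becomes the sum of the squares of the others (\<open>sample_mean_sum_squares_law\<close>).
Given the sample standard deviation, the numerator of the t-statistic is therefore still normal, and
\<open>\<xi> j\<close> is the expectation of two normal tails: this is the \<open>j\<close>-th summand of the denominator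
in the theorem (\<open>rejection_prob_eq_expectation\<close>).  For a null the ratio has the Student law
(\<open>student_ratio_law\<close>), so \<open>\<xi> j = t\<close> (\<open>null_rejection_prob\<close>).  The subtracted term is thus
the quotient of the means of \<open>V\<close> and \<open>R\<close>.

The strong law.  A standard bivariate normal law with correlation \<open>\<rho>\<close> has chi-square
distance \<open>\<rho>\<^sup>2 / (1 - \<rho>\<^sup>2)\<close> from the law of two independent coordinates, so the probabilities of an
event under the two laws differ by at most \<open>2 * \<bar>\<rho>\<bar>\<close> (\<open>correlated_pair_near_independent\<close>).
Replacing the \<open>n\<close> independent rows one at a time costs a factor \<open>n\<close>
(\<open>tensorized_decorrelation\<close>), which bounds the covariance of two rejection indicators by
\<open>2 * n * \<bar>\<sigma> j k\<bar>\<close>.  Weak dependence then makes the variances of \<open>V / p\<close> and \<open>R / p\<close> decay like a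
power of \<open>p\<close>; they are summable along \<open>p = k ^ a\<close> for a large \<open>a\<close>, and since consecutive \<open>a\<close>-th
powers have ratio tending to 1 and the indicators are bounded, convergence along this subsequence
is convergence along all \<open>p\<close> (\<open>weakly_correlated_strong_law\<close>).

The quotient.  Shifting the mean in one direction enlarges one of the two tails, so
\<open>\<xi> j \<ge> t / 2\<close> for every \<open>j\<close> (\<open>rejection_prob_lower_bound\<close>).  The mean of \<open>R / p\<close> stays away from 0,
and the quotient of the two averages converges with its numerator and denominator
(\<open>ratio_difference_tendsto_0\<close>).
\<close>

section \<open>Rotation invariance of the standard normal law\<close>

text \<open>
A rotation with \<open>c \<noteq> 0\<close> factors into two maps that each change one coordinate by an affine function
with the other coordinate fixed, so two one-dimensional substitutions suffice; their Jacobians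
\<open>1 / c\<close> and \<open>c\<close> cancel.  For \<open>c = 0\<close> it is a swap of the coordinates and a reflection.  Stating it, and the lemmas built on it, as equality of all nonnegative
integrals makes Tonelli's theorem directly applicable.
\<close>
lemma lborel_rotation:
  fixes c s :: real and h :: "real \<times> real \<Rightarrow> ennreal"
  assumes cs: "c\<^sup>2 + s\<^sup>2 = 1" and [measurable]: "h \<in> borel_measurable (borel \<Otimes>\<^sub>M borel)"
  shows "(\<integral>\<^sup>+x. \<integral>\<^sup>+y. h (c * x + s * y, c * y - s * x) \<partial>lborel \<partial>lborel) =
    (\<integral>\<^sup>+x. \<integral>\<^sup>+y. h (x, y) \<partial>lborel \<partial>lborel)"
proof (cases "c = 0")
  case False
  have "(\<integral>\<^sup>+x. \<integral>\<^sup>+y. h (c * x + s * y, c * y - s * x) \<partial>lborel \<partial>lborel)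
      = (\<integral>\<^sup>+y. \<integral>\<^sup>+x. h (c * x + s * y, c * y - s * x) \<partial>lborel \<partial>lborel)"
    by (rule lborel_pair.Fubini') simp
  also have "\<dots> = (\<integral>\<^sup>+y. \<bar>1 / c\<bar> * (\<integral>\<^sup>+u. h (u, (y - s * u) / c) \<partial>lborel) \<partial>lborel)"
  proof (rule nn_integral_cong)
    fix y
    have "(y - s * u) / c = c * y - s * (- s * y / c + (1 / c) * u)" for u
    proof -
      have "c * (c * y - s * (- s * y / c + (1 / c) * u)) = (c\<^sup>2 + s\<^sup>2) * y - s * u"
        using False by (simp add: field_simps power2_eq_square)
      then have "c * (c * y - s * (- s * y / c + (1 / c) * u)) = y - s * u" using cs by simp
      then show ?thesis using False by (metis nonzero_mult_div_cancel_left)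
    qed
    then show "(\<integral>\<^sup>+x. h (c * x + s * y, c * y - s * x) \<partial>lborel)
      = \<bar>1 / c\<bar> * (\<integral>\<^sup>+u. h (u, (y - s * u) / c) \<partial>lborel)"
      using False
      by (subst nn_integral_real_affine[where c = "1 / c" and t = "- s * y / c"])
         (auto simp: field_simps)
  qed
  also have "\<dots> = \<bar>1 / c\<bar> * (\<integral>\<^sup>+y. \<integral>\<^sup>+u. h (u, (y - s * u) / c) \<partial>lborel \<partial>lborel)"
    by (rule nn_integral_cmult) simp
  also have "(\<integral>\<^sup>+y. \<integral>\<^sup>+u. h (u, (y - s * u) / c) \<partial>lborel \<partial>lborel)
      = (\<integral>\<^sup>+u. \<integral>\<^sup>+y. h (u, (y - s * u) / c) \<partial>lborel \<partial>lborel)"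
    by (rule lborel_pair.Fubini') simp
  also have "\<dots> = (\<integral>\<^sup>+u. \<bar>c\<bar> * (\<integral>\<^sup>+v. h (u, v) \<partial>lborel) \<partial>lborel)"
  proof (rule nn_integral_cong)
    fix u
    show "(\<integral>\<^sup>+y. h (u, (y - s * u) / c) \<partial>lborel) = \<bar>c\<bar> * (\<integral>\<^sup>+v. h (u, v) \<partial>lborel)"
      using False
      by (subst nn_integral_real_affine[where c = c and t = "s * u"]) auto
  qed
  also have "\<dots> = \<bar>c\<bar> * (\<integral>\<^sup>+u. \<integral>\<^sup>+v. h (u, v) \<partial>lborel \<partial>lborel)"
    by (rule nn_integral_cmult) simp
  finally show ?thesis
    using False by (simp add: mult.assoc[symmetric] ennreal_mult''[symmetric])
next
  case True
  then have s: "\<bar>s\<bar> = 1" "s = 1 \<or> s = -1" "s \<noteq> 0" using cs by (auto simp: power2_eq_1_iff)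
  have "(\<integral>\<^sup>+x. \<integral>\<^sup>+y. h (c * x + s * y, c * y - s * x) \<partial>lborel \<partial>lborel)
      = (\<integral>\<^sup>+x. \<integral>\<^sup>+y. h (s * y, - s * x) \<partial>lborel \<partial>lborel)"
    using True by simp
  also have "\<dots> = (\<integral>\<^sup>+x. \<integral>\<^sup>+y. h (y, - s * x) \<partial>lborel \<partial>lborel)"
  proof (rule nn_integral_cong)
    fix x
    show "(\<integral>\<^sup>+y. h (s * y, - s * x) \<partial>lborel) = (\<integral>\<^sup>+y. h (y, - s * x) \<partial>lborel)"
      using s nn_integral_real_affine[where c = s and t = 0 and f = "\<lambda>y. h (y, - s * x)"]
      by simp
  qed
  also have "\<dots> = (\<integral>\<^sup>+y. \<integral>\<^sup>+x. h (y, - s * x) \<partial>lborel \<partial>lborel)"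
    by (rule lborel_pair.Fubini') simp
  also have "\<dots> = (\<integral>\<^sup>+x. \<integral>\<^sup>+y. h (x, y) \<partial>lborel \<partial>lborel)"
  proof (rule nn_integral_cong)
    fix y
    show "(\<integral>\<^sup>+x. h (y, - s * x) \<partial>lborel) = (\<integral>\<^sup>+x. h (y, x) \<partial>lborel)"
      using s nn_integral_real_affine[where c = "- s" and t = 0 and f = "\<lambda>x. h (y, x)"]
      by simp
  qed
  finally show ?thesis .
qed

abbreviation std_normal :: "real measure" where
  "std_normal \<equiv> std_normal_distribution"

text \<open>
The product density depends on \<open>x\<^sup>2 + y\<^sup>2\<close> only.
\<close>
lemma std_normal_rotation:
  fixes c s :: real and h :: "real \<times> real \<Rightarrow> ennreal"
  assumes cs: "c\<^sup>2 + s\<^sup>2 = 1" and [measurable]: "h \<in> borel_measurable (borel \<Otimes>\<^sub>M borel)"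
  shows "(\<integral>\<^sup>+x. \<integral>\<^sup>+y. h (c * x + s * y, c * y - s * x) \<partial>std_normal \<partial>std_normal) =
    (\<integral>\<^sup>+x. \<integral>\<^sup>+y. h (x, y) \<partial>std_normal \<partial>std_normal)"
proof -
  define \<phi> where "\<phi> z = ennreal (std_normal_density (fst z) * std_normal_density (snd z))" for z
  have [measurable]: "\<phi> \<in> borel_measurable (borel \<Otimes>\<^sub>M borel)"
    unfolding \<phi>_def by simp
  have dens: "(\<integral>\<^sup>+x. \<integral>\<^sup>+y. f (x, y) \<partial>std_normal \<partial>std_normal)
      = (\<integral>\<^sup>+x. \<integral>\<^sup>+y. \<phi> (x, y) * f (x, y) \<partial>lborel \<partial>lborel)"
    if [measurable]: "f \<in> borel_measurable (borel \<Otimes>\<^sub>M borel)" for f :: "real \<times> real \<Rightarrow> ennreal"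
    by (simp add: nn_integral_density \<phi>_def ennreal_mult mult.assoc nn_integral_cmult[symmetric])
  have inv: "\<phi> (c * x + s * y, c * y - s * x) = \<phi> (x, y)" for x y
  proof -
    have "(c * x + s * y)\<^sup>2 + (c * y - s * x)\<^sup>2 = (c\<^sup>2 + s\<^sup>2) * (x\<^sup>2 + y\<^sup>2)"
      by (simp add: power2_eq_square algebra_simps)
    then have "(c * x + s * y)\<^sup>2 + (c * y - s * x)\<^sup>2 = x\<^sup>2 + y\<^sup>2" using cs by simp
    then show ?thesis
      by (simp add: \<phi>_def std_normal_density_def exp_add[symmetric] add_divide_distrib[symmetric]
          flip: minus_add_distrib)
  qed
  have "(\<integral>\<^sup>+x. \<integral>\<^sup>+y. h (c * x + s * y, c * y - s * x) \<partial>std_normal \<partial>std_normal)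
      = (\<integral>\<^sup>+x. \<integral>\<^sup>+y. \<phi> (c * x + s * y, c * y - s * x) * h (c * x + s * y, c * y - s * x) \<partial>lborel \<partial>lborel)"
    using dens[of "\<lambda>z. h (c * fst z + s * snd z, c * snd z - s * fst z)"] by (simp add: inv)
  also have "\<dots> = (\<integral>\<^sup>+x. \<integral>\<^sup>+y. \<phi> (x, y) * h (x, y) \<partial>lborel \<partial>lborel)"
    using lborel_rotation[OF cs, of "\<lambda>z. \<phi> z * h z"] by simp
  finally show ?thesis by (simp add: dens)
qed

lemma prob_space_std_normal: "prob_space std_normal"
  by (rule prob_space_normal_density) simp

interpretation std_normal: prob_space std_normal
  by (rule prob_space_std_normal)

lemma emeasure_std_normal_UNIV [simp]: "emeasure std_normal UNIV = 1"
  using std_normal.emeasure_space_1 by simp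

interpretation std_normal_pair: pair_sigma_finite std_normal std_normal by unfold_locales

interpretation std_normal_PiM: product_prob_space "\<lambda>_. std_normal" UNIV
  by unfold_locales

lemma polar_coordinates_exist:
  fixes a b :: real
  obtains r c s where "r = sqrt (a\<^sup>2 + b\<^sup>2)" "c\<^sup>2 + s\<^sup>2 = 1" "a = r * c" "b = r * s"
proof (cases "sqrt (a\<^sup>2 + b\<^sup>2) = 0")
  case True
  then have "a = 0" "b = 0" by (auto simp: sum_power2_eq_zero_iff)
  then show ?thesis using that[of 0 1 0] by simp
next
  case False
  define r where "r = sqrt (a\<^sup>2 + b\<^sup>2)"
  have "r \<noteq> 0" "r\<^sup>2 = a\<^sup>2 + b\<^sup>2" using False by (auto simp: r_def)
  have "(a / r)\<^sup>2 + (b / r)\<^sup>2 = (a\<^sup>2 + b\<^sup>2) / r\<^sup>2"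
    by (simp add: power_divide add_divide_distrib)
  also have "\<dots> = 1" using \<open>r \<noteq> 0\<close> by (simp flip: \<open>r\<^sup>2 = a\<^sup>2 + b\<^sup>2\<close>)
  finally have "(a / r)\<^sup>2 + (b / r)\<^sup>2 = 1" .
  then show ?thesis using that[of r "a / r" "b / r"] \<open>r \<noteq> 0\<close> by (simp add: r_def)
qed

lemma nn_integral_std_normal_combination:
  fixes f :: "real \<Rightarrow> ennreal"
  assumes [measurable]: "f \<in> borel_measurable borel"
  shows "(\<integral>\<^sup>+x. \<integral>\<^sup>+y. f (a * x + b * y) \<partial>std_normal \<partial>std_normal)
     = (\<integral>\<^sup>+x. f (sqrt (a\<^sup>2 + b\<^sup>2) * x) \<partial>std_normal)"
proof -
  obtain r c s where rcs: "r = sqrt (a\<^sup>2 + b\<^sup>2)" "c\<^sup>2 + s\<^sup>2 = 1" "a = r * c" "b = r * s"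
    by (rule polar_coordinates_exist)
  have "(\<integral>\<^sup>+x. \<integral>\<^sup>+y. f (a * x + b * y) \<partial>std_normal \<partial>std_normal)
      = (\<integral>\<^sup>+x. \<integral>\<^sup>+y. f (r * (c * x + s * y)) \<partial>std_normal \<partial>std_normal)"
    by (simp add: rcs(3,4) algebra_simps)
  also have "\<dots> = (\<integral>\<^sup>+x. \<integral>\<^sup>+y. f (r * x) \<partial>std_normal \<partial>std_normal)"
    using std_normal_rotation[OF rcs(2), of "\<lambda>z. f (r * fst z)"] by simp
  also have "\<dots> = (\<integral>\<^sup>+x. f (r * x) \<partial>std_normal)"
    by simp
  finally show ?thesis by (simp add: rcs(1))
qed

section \<open>The joint law of two coordinates of a normal vector\<close>

text \<open>
The law of two linear forms in \<open>m\<close> independent normal variables depends only on their Gram matrix.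
The right-hand side is the normal form given by the Cholesky factor of that matrix.  When a new
coordinate is added, rotating it against the first variable of the normal form makes the first linear
form a multiple of a single variable again; the two remaining variables occur only in the second form
and merge into one.
\<close>
lemma gaussian_pair_law:
  fixes a b :: "nat \<Rightarrow> real"
  shows "\<exists>\<alpha> \<beta> \<gamma>. \<alpha> \<ge> 0 \<and> \<gamma> \<ge> 0 \<and> \<alpha>\<^sup>2 = (\<Sum>l<m. (a l)\<^sup>2) \<and> \<alpha> * \<beta> = (\<Sum>l<m. a l * b l) \<and>
    \<beta>\<^sup>2 + \<gamma>\<^sup>2 = (\<Sum>l<m. (b l)\<^sup>2) \<and>
    (\<forall>h \<in> borel_measurable (borel \<Otimes>\<^sub>M borel).
      (\<integral>\<^sup>+z. h (\<Sum>l<m. a l * z l, \<Sum>l<m. b l * z l) \<partial>(\<Pi>\<^sub>M l\<in>{..<m}. std_normal)) =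
      (\<integral>\<^sup>+x. \<integral>\<^sup>+y. (h (\<alpha> * x, \<beta> * x + \<gamma> * y) :: ennreal) \<partial>std_normal \<partial>std_normal))"
proof (induction m)
  case 0
  show ?case
    by (intro exI[of _ 0]) (simp add: PiM_empty nn_integral_count_space_finite)
next
  case (Suc m)
  then obtain \<alpha> \<beta> \<gamma> where abc: "\<alpha> \<ge> 0" "\<gamma> \<ge> 0" "\<alpha>\<^sup>2 = (\<Sum>l<m. (a l)\<^sup>2)" "\<alpha> * \<beta> = (\<Sum>l<m. a l * b l)"
      "\<beta>\<^sup>2 + \<gamma>\<^sup>2 = (\<Sum>l<m. (b l)\<^sup>2)"
    and IH: "\<And>h. h \<in> borel_measurable (borel \<Otimes>\<^sub>M borel) \<Longrightarrow>
      (\<integral>\<^sup>+z. h (\<Sum>l<m. a l * z l, \<Sum>l<m. b l * z l) \<partial>(\<Pi>\<^sub>M l\<in>{..<m}. std_normal)) =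
      (\<integral>\<^sup>+x. \<integral>\<^sup>+y. (h (\<alpha> * x, \<beta> * x + \<gamma> * y) :: ennreal) \<partial>std_normal \<partial>std_normal)"
    by blast
  obtain r c s where rcs: "r = sqrt (\<alpha>\<^sup>2 + (a m)\<^sup>2)" "c\<^sup>2 + s\<^sup>2 = 1" "\<alpha> = r * c" "a m = r * s"
    by (rule polar_coordinates_exist)
  define \<beta>' e where "\<beta>' = \<beta> * c + b m * s" and "e = b m * c - \<beta> * s"
  define \<gamma>' where "\<gamma>' = sqrt (e\<^sup>2 + \<gamma>\<^sup>2)"
  have r: "r \<ge> 0" "r\<^sup>2 = \<alpha>\<^sup>2 + (a m)\<^sup>2" by (auto simp: rcs(1))
  have "r * \<beta>' = \<alpha> * \<beta> + a m * b m"
    by (simp add: \<beta>'_def rcs(3,4) algebra_simps)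
  moreover have "\<beta>'\<^sup>2 + \<gamma>'\<^sup>2 = \<beta>\<^sup>2 + \<gamma>\<^sup>2 + (b m)\<^sup>2"
  proof -
    have "\<beta>'\<^sup>2 + e\<^sup>2 = (c\<^sup>2 + s\<^sup>2) * (\<beta>\<^sup>2 + (b m)\<^sup>2)"
      by (simp add: \<beta>'_def e_def power2_eq_square algebra_simps)
    then show ?thesis using rcs(2) by (simp add: \<gamma>'_def)
  qed
  moreover have "(\<integral>\<^sup>+z. h (\<Sum>l<Suc m. a l * z l, \<Sum>l<Suc m. b l * z l) \<partial>(\<Pi>\<^sub>M l\<in>{..<Suc m}. std_normal)) =
      (\<integral>\<^sup>+x. \<integral>\<^sup>+y. (h (r * x, \<beta>' * x + \<gamma>' * y) :: ennreal) \<partial>std_normal \<partial>std_normal)"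
    if [measurable]: "h \<in> borel_measurable (borel \<Otimes>\<^sub>M borel)" for h
  proof -
    have "(\<integral>\<^sup>+z. h (\<Sum>l<Suc m. a l * z l, \<Sum>l<Suc m. b l * z l) \<partial>(\<Pi>\<^sub>M l\<in>{..<Suc m}. std_normal))
       = (\<integral>\<^sup>+z. \<integral>\<^sup>+w. h ((\<Sum>l<m. a l * z l) + a m * w, (\<Sum>l<m. b l * z l) + b m * w)
            \<partial>std_normal \<partial>(\<Pi>\<^sub>M l\<in>{..<m}. std_normal))"
      unfolding lessThan_Suc
      by (subst std_normal_PiM.product_nn_integral_insert) (auto simp: add.commute)
    also have "\<dots> = (\<integral>\<^sup>+x. \<integral>\<^sup>+y. \<integral>\<^sup>+w. h (\<alpha> * x + a m * w, \<beta> * x + \<gamma> * y + b m * w)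
            \<partial>std_normal \<partial>std_normal \<partial>std_normal)"
      using IH[of "\<lambda>u. \<integral>\<^sup>+w. h (fst u + a m * w, snd u + b m * w) \<partial>std_normal"] by simp
    also have "\<dots> = (\<integral>\<^sup>+y. \<integral>\<^sup>+x. \<integral>\<^sup>+w. h (\<alpha> * x + a m * w, \<beta> * x + \<gamma> * y + b m * w)
            \<partial>std_normal \<partial>std_normal \<partial>std_normal)"
      by (rule std_normal_pair.Fubini') simp
    also have "\<dots> = (\<integral>\<^sup>+y. \<integral>\<^sup>+x. \<integral>\<^sup>+w. h (r * x, \<beta>' * x + \<gamma> * y + e * w)
            \<partial>std_normal \<partial>std_normal \<partial>std_normal)"
    proof (rule nn_integral_cong)
      fix y
      have 1: "\<alpha> * x + a m * w = r * (c * x + s * w)" for x w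
        by (simp add: rcs(3,4) algebra_simps)
      have 2: "\<beta> * x + b m * w = \<beta>' * (c * x + s * w) + e * (c * w - s * x)" for x w
      proof -
        have "\<beta>' * (c * x + s * w) + e * (c * w - s * x) = (c\<^sup>2 + s\<^sup>2) * (\<beta> * x + b m * w)"
          by (simp add: \<beta>'_def e_def power2_eq_square algebra_simps)
        then show ?thesis using rcs(2) by simp
      qed
      have 3: "\<beta> * x + \<gamma> * y + b m * w = \<beta>' * (c * x + s * w) + \<gamma> * y + e * (c * w - s * x)" for x w
        using 2[of x w] by simp
      show "(\<integral>\<^sup>+x. \<integral>\<^sup>+w. h (\<alpha> * x + a m * w, \<beta> * x + \<gamma> * y + b m * w) \<partial>std_normal \<partial>std_normal)
        = (\<integral>\<^sup>+x. \<integral>\<^sup>+w. h (r * x, \<beta>' * x + \<gamma> * y + e * w) \<partial>std_normal \<partial>std_normal)"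
        unfolding 1 3
        using std_normal_rotation[OF rcs(2), of "\<lambda>z. h (r * fst z, \<beta>' * fst z + \<gamma> * y + e * snd z)"]
        by simp
    qed
    also have "\<dots> = (\<integral>\<^sup>+x. \<integral>\<^sup>+y. \<integral>\<^sup>+w. h (r * x, \<beta>' * x + \<gamma> * y + e * w)
            \<partial>std_normal \<partial>std_normal \<partial>std_normal)"
      by (rule std_normal_pair.Fubini') simp
    also have "\<dots> = (\<integral>\<^sup>+x. \<integral>\<^sup>+y. h (r * x, \<beta>' * x + \<gamma>' * y) \<partial>std_normal \<partial>std_normal)"
    proof (rule nn_integral_cong)
      fix x
      show "(\<integral>\<^sup>+y. \<integral>\<^sup>+w. h (r * x, \<beta>' * x + \<gamma> * y + e * w) \<partial>std_normal \<partial>std_normal)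
        = (\<integral>\<^sup>+y. h (r * x, \<beta>' * x + \<gamma>' * y) \<partial>std_normal)"
        using nn_integral_std_normal_combination[of "\<lambda>v. h (r * x, \<beta>' * x + v)" \<gamma> e]
        by (simp add: \<gamma>'_def add.assoc add.commute[of "e\<^sup>2"])
    qed
    finally show ?thesis .
  qed
  moreover have "\<gamma>' \<ge> 0" by (simp add: \<gamma>'_def)
  ultimately show ?case using abc r
    by (intro exI[of _ r] exI[of _ \<beta>'] exI[of _ \<gamma>']) auto
qed

lemma correlated_pair_law:
  fixes a b :: "nat \<Rightarrow> real"
  assumes "(\<Sum>l<m. (a l)\<^sup>2) = 1" "(\<Sum>l<m. (b l)\<^sup>2) = 1" and \<rho>: "(\<Sum>l<m. a l * b l) = \<rho>"
    and h: "h \<in> borel_measurable (borel \<Otimes>\<^sub>M borel)"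
  shows "(\<integral>\<^sup>+z. h (\<Sum>l<m. a l * z l, \<Sum>l<m. b l * z l) \<partial>(\<Pi>\<^sub>M l\<in>{..<m}. std_normal)) =
      (\<integral>\<^sup>+x. \<integral>\<^sup>+y. (h (x, \<rho> * x + sqrt (1 - \<rho>\<^sup>2) * y) :: ennreal) \<partial>std_normal \<partial>std_normal)"
proof -
  obtain \<alpha> \<beta> \<gamma> where *: "\<alpha> \<ge> 0" "\<gamma> \<ge> 0" "\<alpha>\<^sup>2 = (\<Sum>l<m. (a l)\<^sup>2)" "\<alpha> * \<beta> = (\<Sum>l<m. a l * b l)"
      "\<beta>\<^sup>2 + \<gamma>\<^sup>2 = (\<Sum>l<m. (b l)\<^sup>2)"
    and law: "(\<integral>\<^sup>+z. h (\<Sum>l<m. a l * z l, \<Sum>l<m. b l * z l) \<partial>(\<Pi>\<^sub>M l\<in>{..<m}. std_normal)) =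
      (\<integral>\<^sup>+x. \<integral>\<^sup>+y. (h (\<alpha> * x, \<beta> * x + \<gamma> * y) :: ennreal) \<partial>std_normal \<partial>std_normal)"
    using gaussian_pair_law[of a m b] h by blast
  have "\<alpha> = 1" using *(1,3) assms by (simp add: power2_eq_1_iff)
  moreover have "\<beta> = \<rho>" using *(4) \<rho> \<open>\<alpha> = 1\<close> by simp
  moreover have "\<gamma> = sqrt (1 - \<rho>\<^sup>2)"
    using *(2,5) assms(2) \<open>\<beta> = \<rho>\<close> by (intro real_sqrt_unique[symmetric]) auto
  ultimately show ?thesis using law by simp
qed

text \<open>
The standard bivariate normal law with correlation \<open>\<rho>\<close>.
\<close>
definition correlated_pair :: "real \<Rightarrow> (real \<times> real) measure" where
  "correlated_pair \<rho> = distr (std_normal \<Otimes>\<^sub>M std_normal) (borel \<Otimes>\<^sub>M borel)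
     (\<lambda>z. (fst z, \<rho> * fst z + sqrt (1 - \<rho>\<^sup>2) * snd z))"

lemma sets_correlated_pair [simp, measurable_cong]: "sets (correlated_pair \<rho>) = sets (borel \<Otimes>\<^sub>M borel)"
  by (simp add: correlated_pair_def)

lemma prob_space_correlated_pair: "prob_space (correlated_pair \<rho>)"
  unfolding correlated_pair_def
  by (intro prob_space.prob_space_distr prob_space_pair prob_space_std_normal) simp

lemma distr_correlated_pair_fst: "distr (correlated_pair \<rho>) borel fst = std_normal"
proof (rule measure_eqI)
  fix A assume "A \<in> sets (distr (correlated_pair \<rho>) borel fst)"
  then have [measurable]: "A \<in> sets borel" by simp
  have "emeasure (distr (correlated_pair \<rho>) borel fst) A = (\<integral>\<^sup>+z. indicator A (fst z) \<partial>(std_normal \<Otimes>\<^sub>M std_normal))"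
    by (subst nn_integral_indicator[symmetric]) (simp_all add: correlated_pair_def distr_distr nn_integral_distr del: nn_integral_indicator)
  also have "\<dots> = emeasure std_normal A"
    by (subst std_normal.nn_integral_fst[symmetric]) simp_all
  finally show "emeasure (distr (correlated_pair \<rho>) borel fst) A = emeasure std_normal A" .
qed simp

text \<open>
The dependence between two variables enters all later arguments only through this bivariate law,
that is, through a single correlation.
\<close>
lemma multivariate_normal_pair_law:
  assumes "multivariate_normal M p Y \<mu> S" and jk: "j < p" "k < p" and "S j j = 1" "S k k = 1"
  shows "distr M (borel \<Otimes>\<^sub>M borel) (\<lambda>\<omega>. (Y j \<omega> - \<mu> j, Y k \<omega> - \<mu> k)) = correlated_pair (S j k)"
proof -
  obtain m A where Y: "\<And>j. j < p \<Longrightarrow> Y j \<in> borel_measurable M"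
    and S: "\<And>j k. j < p \<Longrightarrow> k < p \<Longrightarrow> S j k = (\<Sum>l<m::nat. A j l * A k l)"
    and law: "distr M (\<Pi>\<^sub>M j\<in>{..<p}. borel) (\<lambda>\<omega>. \<lambda>j\<in>{..<p}. Y j \<omega>) =
        distr (\<Pi>\<^sub>M l\<in>{..<m}. std_normal) (\<Pi>\<^sub>M j\<in>{..<p}. borel)
          (\<lambda>z. \<lambda>j\<in>{..<p}. \<mu> j + (\<Sum>l<m. A j l * z l))"
    using assms(1) unfolding multivariate_normal_def by blast
  have [measurable]: "Y j \<in> borel_measurable M" "Y k \<in> borel_measurable M" using Y jk by auto
  have [measurable]: "(\<lambda>\<omega>. \<lambda>j\<in>{..<p}. Y j \<omega>) \<in> M \<rightarrow>\<^sub>M (\<Pi>\<^sub>M j\<in>{..<p}. borel)"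
    using Y by (intro measurable_restrict) auto
  have [measurable]: "(\<lambda>z. \<lambda>j\<in>{..<p}. \<mu> j + (\<Sum>l<m. A j l * z l)) \<in> (\<Pi>\<^sub>M l\<in>{..<m}. std_normal) \<rightarrow>\<^sub>M (\<Pi>\<^sub>M j\<in>{..<p}. borel)"
    by (intro measurable_restrict) simp
  let ?c = "\<lambda>x :: nat \<Rightarrow> real. (x j - \<mu> j, x k - \<mu> k)"
  have c[measurable]: "?c \<in> (\<Pi>\<^sub>M j\<in>{..<p}. borel) \<rightarrow>\<^sub>M borel \<Otimes>\<^sub>M borel"
    using jk by simp
  have "distr M (borel \<Otimes>\<^sub>M borel) (\<lambda>\<omega>. (Y j \<omega> - \<mu> j, Y k \<omega> - \<mu> k))
      = distr (distr M (\<Pi>\<^sub>M j\<in>{..<p}. borel) (\<lambda>\<omega>. \<lambda>j\<in>{..<p}. Y j \<omega>)) (borel \<Otimes>\<^sub>M borel) ?c"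
    using jk by (subst distr_distr) (auto simp: comp_def)
  also have "\<dots> = distr (\<Pi>\<^sub>M l\<in>{..<m}. std_normal) (borel \<Otimes>\<^sub>M borel)
      (\<lambda>z. (\<Sum>l<m. A j l * z l, \<Sum>l<m. A k l * z l))"
    unfolding law using jk by (subst distr_distr) (auto simp: comp_def)
  also have "\<dots> = correlated_pair (S j k)"
  proof (rule measure_eqI)
    let ?D = "distr (\<Pi>\<^sub>M l\<in>{..<m}. std_normal) (borel \<Otimes>\<^sub>M borel) (\<lambda>z. (\<Sum>l<m. A j l * z l, \<Sum>l<m. A k l * z l))"
    fix E assume "E \<in> sets ?D"
    then have [measurable]: "E \<in> sets (borel \<Otimes>\<^sub>M borel)" by simp
    have "emeasure ?D E = (\<integral>\<^sup>+z. indicator E (\<Sum>l<m. A j l * z l, \<Sum>l<m. A k l * z l) \<partial>(\<Pi>\<^sub>M l\<in>{..<m}. std_normal))"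
      by (subst nn_integral_indicator[symmetric]) (simp_all add: nn_integral_distr del: nn_integral_indicator)
    also have "\<dots> = (\<integral>\<^sup>+x. \<integral>\<^sup>+y. indicator E (x, S j k * x + sqrt (1 - (S j k)\<^sup>2) * y) \<partial>std_normal \<partial>std_normal)"
      using assms(4,5) S jk by (intro correlated_pair_law) (simp_all add: power2_eq_square)
    also have "\<dots> = (\<integral>\<^sup>+z. indicator E (fst z, S j k * fst z + sqrt (1 - (S j k)\<^sup>2) * snd z) \<partial>(std_normal \<Otimes>\<^sub>M std_normal))"
      by (subst std_normal.nn_integral_fst[symmetric]) simp_all
    also have "\<dots> = emeasure (correlated_pair (S j k)) E"
      by (subst nn_integral_indicator[symmetric]) (simp_all add: correlated_pair_def nn_integral_distr del: nn_integral_indicator)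
    finally show "emeasure ?D E = emeasure (correlated_pair (S j k)) E" .
  qed simp
  finally show ?thesis .
qed

section \<open>Sample mean and sample variance of a normal sample\<close>

definition chi_square :: "nat \<Rightarrow> real measure" where
  "chi_square k = distr (\<Pi>\<^sub>M i\<in>{..<k}. std_normal) borel (\<lambda>z. \<Sum>i<k. (z i)\<^sup>2)"

lemma sets_chi_square [measurable_cong, simp]: "sets (chi_square k) = sets borel"
  by (simp add: chi_square_def)

lemma space_chi_square [simp]: "space (chi_square k) = UNIV"
  by (simp add: chi_square_def)

lemma prob_space_PiM_std_normal: "prob_space (\<Pi>\<^sub>M i\<in>I. std_normal)"
  by (intro prob_space_PiM prob_space_std_normal)

lemma prob_space_chi_square: "prob_space (chi_square k)"
  unfolding chi_square_def
  by (intro prob_space.prob_space_distr prob_space_PiM_std_normal) simp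

lemma emeasure_chi_square_UNIV [simp]: "emeasure (chi_square k) UNIV = 1"
  using prob_space.emeasure_space_1[OF prob_space_chi_square[of k]] by simp

lemma nn_integral_chi_square_0:
  "f \<in> borel_measurable borel \<Longrightarrow> (\<integral>\<^sup>+s. f s \<partial>chi_square 0) = f 0"
  by (simp add: chi_square_def nn_integral_distr PiM_empty nn_integral_count_space_finite)

lemma nn_integral_chi_square_Suc:
  assumes [measurable]: "f \<in> borel_measurable borel"
  shows "(\<integral>\<^sup>+s. f s \<partial>chi_square (Suc k)) = (\<integral>\<^sup>+s. \<integral>\<^sup>+w. f (s + w\<^sup>2) \<partial>std_normal \<partial>chi_square k)"
proof -
  have "(\<integral>\<^sup>+s. f s \<partial>chi_square (Suc k))
      = (\<integral>\<^sup>+z. f (\<Sum>i<Suc k. (z i)\<^sup>2) \<partial>(\<Pi>\<^sub>M i\<in>{..<Suc k}. std_normal))"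
    unfolding chi_square_def by (subst nn_integral_distr) auto
  also have "\<dots> = (\<integral>\<^sup>+z. \<integral>\<^sup>+w. f ((\<Sum>i<k. (z i)\<^sup>2) + w\<^sup>2) \<partial>std_normal \<partial>(\<Pi>\<^sub>M i\<in>{..<k}. std_normal))"
    unfolding lessThan_Suc
    by (subst std_normal_PiM.product_nn_integral_insert) (auto simp: add.commute)
  also have "\<dots> = (\<integral>\<^sup>+s. \<integral>\<^sup>+w. f (s + w\<^sup>2) \<partial>std_normal \<partial>chi_square k)"
    unfolding chi_square_def by (subst nn_integral_distr) auto
  finally show ?thesis .
qed

text \<open>
The sample standard deviation is almost surely nonzero, which excludes the junk value of the
t-statistic at 0.
\<close>
lemma AE_chi_square_pos:
  assumes "k > 0"
  shows "AE s in chi_square k. s > 0"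
proof -
  obtain m where m: "k = Suc m" using assms by (cases k) auto
  have nz: "AE w in std_normal. w \<noteq> 0"
    using AE_lborel_singleton[of "0::real"] by (subst AE_density) auto
  have nonneg: "AE s in chi_square m. s \<ge> 0"
    unfolding chi_square_def by (subst AE_distr_iff) (auto intro!: AE_I2 sum_nonneg)
  have "emeasure (chi_square k) {..0} = (\<integral>\<^sup>+s. \<integral>\<^sup>+w. indicator {..0} (s + w\<^sup>2) \<partial>std_normal \<partial>chi_square m)"
    unfolding m by (subst nn_integral_chi_square_Suc[symmetric]) auto
  also have "\<dots> = (\<integral>\<^sup>+s. \<integral>\<^sup>+w. 0 \<partial>std_normal \<partial>chi_square m)"
  proof (rule nn_integral_cong_AE)
    show "AE s in chi_square m. (\<integral>\<^sup>+w. indicator {..0} (s + w\<^sup>2) \<partial>std_normal) = (\<integral>\<^sup>+w. (0::ennreal) \<partial>std_normal)"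
      using nonneg
    proof eventually_elim
      case (elim s)
      have "AE w in std_normal. (indicator {..0} (s + w\<^sup>2) :: ennreal) = 0"
        using nz
      proof eventually_elim
        case (elim w)
        then have "w\<^sup>2 > 0" by simp
        then have "\<not> s + w\<^sup>2 \<le> 0" using \<open>0 \<le> s\<close> by linarith
        then show ?case by simp
      qed
      then show ?case by (rule nn_integral_cong_AE)
    qed
  qed
  finally have "emeasure (chi_square k) {..0} = 0" by simp
  then have "{..0} \<in> null_sets (chi_square k)" by (auto intro: null_setsI)
  then have "AE s in chi_square k. s \<notin> {..0}" by (rule AE_not_in)
  then show ?thesis by eventually_elim auto
qed

text \<open>
Let \<open>L\<close> and \<open>Q\<close> be the sum and the sum of squares of \<open>m\<close> observations, and let \<open>w\<close> be a further
observation.  The plane rotation with cosine \<open>c\<close> and sine \<open>s\<close>, applied to the scaled mean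
\<open>L / sqrt m\<close> and \<open>w\<close>, yields the scaled mean of all \<open>m + 1\<close> observations in one coordinate, and in
the other a quantity whose square is the increment of the sum of squared deviations.
\<close>
lemma helmert_step:
  fixes L Q w :: real
  assumes "m > 0"
  defines "c \<equiv> sqrt (m / (m + 1))" and "s \<equiv> sqrt (1 / (m + 1))"
  shows "c\<^sup>2 + s\<^sup>2 = 1"
    and "c * (L / sqrt m) + s * w = (L + w) / sqrt (m + 1)"
    and "(Q - L\<^sup>2 / m) + (c * w - s * (L / sqrt m))\<^sup>2 = Q + w\<^sup>2 - (L + w)\<^sup>2 / (m + 1)"
proof -
  have c2: "c\<^sup>2 = m / (m + 1)" and s2: "s\<^sup>2 = 1 / (m + 1)" using assms by auto
  show "c\<^sup>2 + s\<^sup>2 = 1" unfolding c2 s2 using assms(1) by (simp add: field_simps)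
  have cs: "c = sqrt m * s" using assms by (simp add: real_sqrt_divide)
  show "c * (L / sqrt m) + s * w = (L + w) / sqrt (m + 1)"
    unfolding cs using assms(1) by (simp add: s_def real_sqrt_divide add_divide_distrib)
  have "c * w - s * (L / sqrt m) = s * (sqrt m * w - L / sqrt m)"
    unfolding cs by (simp add: algebra_simps)
  also have "\<dots>\<^sup>2 = s\<^sup>2 * (m * w\<^sup>2 - 2 * w * L + L\<^sup>2 / m)"
    using assms(1) by (simp add: power_mult_distrib power2_diff power_divide)
  also have "\<dots> = (m * w\<^sup>2 - 2 * w * L + L\<^sup>2 / m) / (m + 1)" by (simp add: s2)
  also have "(Q - L\<^sup>2 / m) + \<dots> = Q + w\<^sup>2 - (L + w)\<^sup>2 / (m + 1)"
    using assms(1) by (simp add: divide_simps) (simp add: power2_eq_square algebra_simps)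
  finally show "(Q - L\<^sup>2 / m) + (c * w - s * (L / sqrt m))\<^sup>2 = Q + w\<^sup>2 - (L + w)\<^sup>2 / (m + 1)" .
qed

text \<open>
Induction over the observations: by \<open>helmert_step\<close> each new observation contributes one
independent squared normal variable to the sum of squared deviations and leaves the scaled mean
standard normal and independent of it.
\<close>
lemma sample_mean_sum_squares_law:
  fixes h :: "real \<times> real \<Rightarrow> ennreal"
  assumes "h \<in> borel_measurable (borel \<Otimes>\<^sub>M borel)"
  shows "(\<integral>\<^sup>+z. h ((\<Sum>i<Suc k. z i) / sqrt (Suc k), (\<Sum>i<Suc k. (z i)\<^sup>2) - (\<Sum>i<Suc k. z i)\<^sup>2 / (Suc k))
        \<partial>(\<Pi>\<^sub>M i\<in>{..<Suc k}. std_normal)) =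
      (\<integral>\<^sup>+s. \<integral>\<^sup>+u. h (u, s) \<partial>std_normal \<partial>chi_square k)"
  using assms
proof (induction k arbitrary: h)
  case 0
  note [measurable] = this
  have "(\<integral>\<^sup>+z. h (z 0, 0) \<partial>(\<Pi>\<^sub>M i\<in>{0}. std_normal)) = (\<integral>\<^sup>+u. h (u, 0) \<partial>std_normal)"
    by (rule std_normal_PiM.product_nn_integral_singleton) simp
  then show ?case by (simp add: lessThan_Suc nn_integral_chi_square_0)
next
  case (Suc k)
  note [measurable] = Suc.prems
  interpret chi: prob_space "chi_square k" by (rule prob_space_chi_square)
  interpret chi_N: pair_sigma_finite "chi_square k" std_normal by unfold_locales
  define m where "m = real (Suc k)"
  have m: "m > 0" "real (Suc (Suc k)) = m + 1" by (auto simp: m_def)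
  define c s where "c = sqrt (m / (m + 1))" and "s = sqrt (1 / (m + 1))"
  note step = helmert_step[OF m(1), folded c_def s_def]
  let ?P = "\<Pi>\<^sub>M i\<in>{..<Suc k}. std_normal"
  have "(\<integral>\<^sup>+z. h ((\<Sum>i<Suc (Suc k). z i) / sqrt (Suc (Suc k)),
          (\<Sum>i<Suc (Suc k). (z i)\<^sup>2) - (\<Sum>i<Suc (Suc k). z i)\<^sup>2 / (Suc (Suc k)))
        \<partial>(\<Pi>\<^sub>M i\<in>{..<Suc (Suc k)}. std_normal))
     = (\<integral>\<^sup>+z. \<integral>\<^sup>+w. h (((\<Sum>i<Suc k. z i) + w) / sqrt (m + 1),
          (\<Sum>i<Suc k. (z i)\<^sup>2) + w\<^sup>2 - ((\<Sum>i<Suc k. z i) + w)\<^sup>2 / (m + 1)) \<partial>std_normal \<partial>?P)"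
    unfolding lessThan_Suc[of "Suc k"] m(2)
    by (subst std_normal_PiM.product_nn_integral_insert) (auto simp: add.commute)
  also have "\<dots> = (\<integral>\<^sup>+z. \<integral>\<^sup>+w. h (c * ((\<Sum>i<Suc k. z i) / sqrt m) + s * w,
          ((\<Sum>i<Suc k. (z i)\<^sup>2) - (\<Sum>i<Suc k. z i)\<^sup>2 / m) + (c * w - s * ((\<Sum>i<Suc k. z i) / sqrt m))\<^sup>2)
          \<partial>std_normal \<partial>?P)"
    unfolding step(2,3) ..
  also have "\<dots> = (\<integral>\<^sup>+q. \<integral>\<^sup>+u. \<integral>\<^sup>+w. h (c * u + s * w, q + (c * w - s * u)\<^sup>2)
        \<partial>std_normal \<partial>std_normal \<partial>chi_square k)"
    using Suc.IH[of "\<lambda>v. \<integral>\<^sup>+w. h (c * fst v + s * w, snd v + (c * w - s * fst v)\<^sup>2) \<partial>std_normal"]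
    by (simp add: m_def)
  also have "\<dots> = (\<integral>\<^sup>+q. \<integral>\<^sup>+u. \<integral>\<^sup>+w. h (u, q + w\<^sup>2) \<partial>std_normal \<partial>std_normal \<partial>chi_square k)"
  proof (rule nn_integral_cong)
    fix q
    show "(\<integral>\<^sup>+u. \<integral>\<^sup>+w. h (c * u + s * w, q + (c * w - s * u)\<^sup>2) \<partial>std_normal \<partial>std_normal)
      = (\<integral>\<^sup>+u. \<integral>\<^sup>+w. h (u, q + w\<^sup>2) \<partial>std_normal \<partial>std_normal)"
      using std_normal_rotation[OF step(1), of "\<lambda>v. h (fst v, q + (snd v)\<^sup>2)"] by simp
  qed
  also have "\<dots> = (\<integral>\<^sup>+q. \<integral>\<^sup>+w. \<integral>\<^sup>+u. h (u, q + w\<^sup>2) \<partial>std_normal \<partial>std_normal \<partial>chi_square k)"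
    by (intro nn_integral_cong std_normal_pair.Fubini') simp
  also have "\<dots> = (\<integral>\<^sup>+q. \<integral>\<^sup>+u. h (u, q) \<partial>std_normal \<partial>chi_square (Suc k))"
    by (rule nn_integral_chi_square_Suc[symmetric]) simp
  finally show ?case .
qed

text \<open>
Multiplying the normal density by this Gaussian factor rescales it to variance \<open>1 / r\<^sup>2\<close>.
\<close>
lemma std_normal_tilt:
  fixes g :: "real \<Rightarrow> ennreal" and r :: real
  assumes r: "r > 0" and [measurable]: "g \<in> borel_measurable borel"
  shows "(\<integral>\<^sup>+w. g w * ennreal (exp (- ((r\<^sup>2 - 1) / 2 * w\<^sup>2))) \<partial>std_normal)
     = ennreal (1 / r) * (\<integral>\<^sup>+w. g (w / r) \<partial>std_normal)"
proof -
  have "(\<integral>\<^sup>+w. g w * ennreal (exp (- ((r\<^sup>2 - 1) / 2 * w\<^sup>2))) \<partial>std_normal)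
      = (\<integral>\<^sup>+w. g w * ennreal (std_normal_density (r * w)) \<partial>lborel)"
  proof (subst nn_integral_density, simp, simp, rule nn_integral_cong)
    fix w
    have "std_normal_density w * exp (- ((r\<^sup>2 - 1) / 2 * w\<^sup>2)) = std_normal_density (r * w)"
      by (simp add: std_normal_density_def exp_add[symmetric] field_simps)
    then show "ennreal (std_normal_density w) * (g w * ennreal (exp (- ((r\<^sup>2 - 1) / 2 * w\<^sup>2))))
      = g w * ennreal (std_normal_density (r * w))"
      by (simp add: ennreal_mult'[symmetric] mult_ac)
  qed
  also have "\<dots> = ennreal (1 / r) * (\<integral>\<^sup>+w. g (w / r) * ennreal (std_normal_density w) \<partial>lborel)"
    using r by (subst nn_integral_real_affine[where c = "1 / r" and t = 0]) auto
  also have "(\<integral>\<^sup>+w. g (w / r) * ennreal (std_normal_density w) \<partial>lborel) = (\<integral>\<^sup>+w. g (w / r) \<partial>std_normal)"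
    by (simp add: nn_integral_density mult.commute)
  finally show ?thesis .
qed

text \<open>
Exponential tilting rescales the chi-square law, because it rescales each of the normal variables
that are squared.  This yields the Student density below without a formula for the
chi-square density.
\<close>
lemma chi_square_tilt:
  fixes f :: "real \<Rightarrow> ennreal" and r :: real
  assumes r: "r > 0" and "f \<in> borel_measurable borel"
  shows "(\<integral>\<^sup>+s. f s * ennreal (exp (- ((r\<^sup>2 - 1) / 2 * s))) \<partial>chi_square k)
     = ennreal ((1 / r) ^ k) * (\<integral>\<^sup>+s. f (s / r\<^sup>2) \<partial>chi_square k)"
  using assms(2)
proof (induction k arbitrary: f)
  case 0
  then show ?case by (simp add: nn_integral_chi_square_0)
next
  case (Suc k)
  note [measurable] = Suc.prems
  let ?e = "\<lambda>s. ennreal (exp (- ((r\<^sup>2 - 1) / 2 * s)))"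
  have e_add: "?e (s + u) = ?e u * ?e s" for s u
  proof -
    have "- ((r\<^sup>2 - 1) / 2 * (s + u)) = - ((r\<^sup>2 - 1) / 2 * u) + - ((r\<^sup>2 - 1) / 2 * s)"
      by (simp only: distrib_left minus_add_distrib add.commute)
    then show ?thesis by (simp only: exp_add ennreal_mult' exp_ge_zero)
  qed
  have "(\<integral>\<^sup>+s. f s * ?e s \<partial>chi_square (Suc k))
      = (\<integral>\<^sup>+s. \<integral>\<^sup>+w. f (s + w\<^sup>2) * ?e (s + w\<^sup>2) \<partial>std_normal \<partial>chi_square k)"
    by (rule nn_integral_chi_square_Suc) simp
  also have "\<dots> = (\<integral>\<^sup>+s. (\<integral>\<^sup>+w. f (s + w\<^sup>2) * ?e (w\<^sup>2) \<partial>std_normal) * ?e s \<partial>chi_square k)"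
    unfolding e_add mult.assoc[symmetric]
    by (intro nn_integral_cong nn_integral_multc) simp_all
  also have "\<dots> = (\<integral>\<^sup>+s. (ennreal (1 / r) * (\<integral>\<^sup>+w. f (s + (w / r)\<^sup>2) \<partial>std_normal)) * ?e s \<partial>chi_square k)"
    by (intro nn_integral_cong arg_cong2[where f = "(*)"] refl std_normal_tilt r) simp
  also have "\<dots> = ennreal ((1 / r) ^ k) * (\<integral>\<^sup>+s. ennreal (1 / r) * (\<integral>\<^sup>+w. f (s / r\<^sup>2 + (w / r)\<^sup>2) \<partial>std_normal) \<partial>chi_square k)"
    by (rule Suc.IH) simp
  also have "\<dots> = ennreal ((1 / r) ^ k) * (ennreal (1 / r) * (\<integral>\<^sup>+s. \<integral>\<^sup>+w. f ((s + w\<^sup>2) / r\<^sup>2) \<partial>std_normal \<partial>chi_square k))"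
    by (subst nn_integral_cmult) (auto simp: power_divide add_divide_distrib)
  also have "(\<integral>\<^sup>+s. \<integral>\<^sup>+w. f ((s + w\<^sup>2) / r\<^sup>2) \<partial>std_normal \<partial>chi_square k) = (\<integral>\<^sup>+s. f (s / r\<^sup>2) \<partial>chi_square (Suc k))"
    by (rule nn_integral_chi_square_Suc[symmetric]) simp
  finally show ?case
    using r by (simp add: mult.assoc[symmetric] ennreal_mult'[symmetric] mult.commute)
qed

lemma sample_mean_shift: "n > 0 \<Longrightarrow> sample_mean n (\<lambda>i. m + z i) = m + sample_mean n z"
  by (simp add: sample_mean_def sum.distrib add_divide_distrib)

lemma sample_sd_shift: "n > 0 \<Longrightarrow> sample_sd n (\<lambda>i. m + z i) = sample_sd n z"
  by (simp add: sample_sd_def sample_mean_shift)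

lemma sample_sd_eq:
  assumes "n > 0"
  shows "sample_sd n z = sqrt (((\<Sum>i<n. (z i)\<^sup>2) - (\<Sum>i<n. z i)\<^sup>2 / real n) / (real n - 1))"
proof -
  define c where "c = sample_mean n z"
  have sum: "(\<Sum>i<n. z i) = real n * c" using assms by (simp add: c_def sample_mean_def)
  have "(\<Sum>i<n. (z i - c)\<^sup>2) = (\<Sum>i<n. (z i)\<^sup>2 - 2 * c * z i + c\<^sup>2)"
    by (intro sum.cong refl) (simp add: power2_diff algebra_simps)
  also have "\<dots> = (\<Sum>i<n. (z i)\<^sup>2) - 2 * c * (\<Sum>i<n. z i) + real n * c\<^sup>2"
    by (simp add: sum.distrib sum_subtractf sum_distrib_left)
  also have "\<dots> = (\<Sum>i<n. (z i)\<^sup>2) - (\<Sum>i<n. z i)\<^sup>2 / real n"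
    using assms unfolding sum by (simp add: power2_eq_square field_simps)
  finally show ?thesis by (simp add: sample_sd_def c_def)
qed

lemma measurable_sample_functions:
  assumes [measurable]: "\<And>i. i < n \<Longrightarrow> (\<lambda>\<omega>. x \<omega> i) \<in> borel_measurable M"
  shows "(\<lambda>\<omega>. sample_mean n (x \<omega>)) \<in> borel_measurable M"
    and "(\<lambda>\<omega>. sample_sd n (x \<omega>)) \<in> borel_measurable M"
    and "(\<lambda>\<omega>. t_stat n (x \<omega>)) \<in> borel_measurable M"
    and "Measurable.pred M (\<lambda>\<omega>. rejects n t (x \<omega>))"
proof -
  show 1[measurable]: "(\<lambda>\<omega>. sample_mean n (x \<omega>)) \<in> borel_measurable M"
    unfolding sample_mean_def by measurable
  show 2[measurable]: "(\<lambda>\<omega>. sample_sd n (x \<omega>)) \<in> borel_measurable M"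
    unfolding sample_sd_def by measurable
  show 3[measurable]: "(\<lambda>\<omega>. t_stat n (x \<omega>)) \<in> borel_measurable M"
    unfolding t_stat_def by measurable
  show "Measurable.pred M (\<lambda>\<omega>. rejects n t (x \<omega>))"
    unfolding rejects_def by measurable
qed

text \<open>
The normalization of \<open>sample_mean_sum_squares_law\<close> that occurs in the t-statistic.
\<close>
lemma sample_mean_sd_law:
  fixes h :: "real \<times> real \<Rightarrow> ennreal"
  assumes n: "n > 0" and [measurable]: "h \<in> borel_measurable (borel \<Otimes>\<^sub>M borel)"
  shows "(\<integral>\<^sup>+z. h (sqrt n * sample_mean n z, sample_sd n z) \<partial>(\<Pi>\<^sub>M i\<in>{..<n}. std_normal)) =
    (\<integral>\<^sup>+s. \<integral>\<^sup>+u. h (u, sqrt (s / real (n - 1))) \<partial>std_normal \<partial>chi_square (n - 1))"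
proof -
  note [measurable] = measurable_sample_functions
  obtain k where k: "n = Suc k" using n by (cases n) auto
  have 1: "sqrt n * sample_mean n z = (\<Sum>i<Suc k. z i) / sqrt (Suc k)" for z
  proof -
    have "sqrt n / real n = 1 / sqrt n"
      using sqrt_divide_self_eq[of "real n"] by (simp add: inverse_eq_divide)
    then have "sqrt n * ((\<Sum>i<n. z i) / real n) = (\<Sum>i<n. z i) / sqrt n"
      by (metis mult.commute times_divide_eq_left times_divide_eq_right mult_1)
    then show ?thesis by (simp add: sample_mean_def k)
  qed
  have 2: "sample_sd n z = sqrt (((\<Sum>i<Suc k. (z i)\<^sup>2) - (\<Sum>i<Suc k. z i)\<^sup>2 / (Suc k)) / real k)" for z
    using sample_sd_eq[OF n, of z] unfolding k by simp
  show ?thesis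
    unfolding 1 2
    using sample_mean_sum_squares_law[of "\<lambda>v. h (fst v, sqrt (snd v / real k))" k]
    by (simp add: k)
qed

lemma sample_mean_cong: "(\<And>i. i < n \<Longrightarrow> x i = y i) \<Longrightarrow> sample_mean n x = sample_mean n y"
  by (simp add: sample_mean_def)

lemma sample_sd_cong:
  assumes "\<And>i. i < n \<Longrightarrow> x i = y i" shows "sample_sd n x = sample_sd n y"
  using sample_mean_cong[of n x y] assms by (simp add: sample_sd_def)

lemma rejects_cong:
  assumes "\<And>i. i < n \<Longrightarrow> x i = y i" shows "rejects n t x = rejects n t y"
  using sample_mean_cong[of n x y] sample_sd_cong[of n x y] assms by (simp add: rejects_def t_stat_def)

section \<open>The Student distribution and its quantiles\<close>

lemma nn_integral_Gamma_scaled: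
  fixes b A :: real
  assumes "b > 0" "A > 0"
  shows "(\<integral>\<^sup>+x. ennreal (indicator {0..} x * x powr (b - 1) * exp (- (A * x))) \<partial>lborel)
    = ennreal (Gamma b * A powr (- b))"
proof -
  have "ennreal (Gamma b) = (\<integral>\<^sup>+x. ennreal (indicator {0..} x * x powr (b - 1) / exp x) \<partial>lborel)"
    by (rule Gamma_conv_nn_integral_real) fact
  also have "\<dots> = ennreal A * (\<integral>\<^sup>+x. ennreal (indicator {0..} (A * x) * (A * x) powr (b - 1) / exp (A * x)) \<partial>lborel)"
    using assms by (subst nn_integral_real_affine[where c = A and t = 0]) auto
  also have "\<dots> = (\<integral>\<^sup>+x. ennreal (A powr b) * ennreal (indicator {0..} x * x powr (b - 1) * exp (- (A * x))) \<partial>lborel)"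
  proof (subst nn_integral_cmult[symmetric], simp, rule nn_integral_cong)
    fix x
    have "A * (indicator {0..} (A * x) * (A * x) powr (b - 1) / exp (A * x))
      = A powr b * (indicator {0..} x * x powr (b - 1) * exp (- (A * x)))"
    proof (cases "x \<ge> 0")
      case True
      have "A * A powr (b - 1) = A powr b" using assms by (simp add: powr_diff)
      then show ?thesis using True assms
        by (simp add: powr_mult exp_minus field_simps)
    next
      case False
      then show ?thesis using assms by (simp add: zero_le_mult_iff)
    qed
    then show "ennreal A * ennreal (indicator {0..} (A * x) * (A * x) powr (b - 1) / exp (A * x))
      = ennreal (A powr b) * ennreal (indicator {0..} x * x powr (b - 1) * exp (- (A * x)))"
      using assms by (simp add: ennreal_mult'[symmetric])
  qed
  also have "\<dots> = ennreal (A powr b) * (\<integral>\<^sup>+x. ennreal (indicator {0..} x * x powr (b - 1) * exp (- (A * x))) \<partial>lborel)"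
    by (rule nn_integral_cmult) simp
  finally have "ennreal (A powr (- b)) * ennreal (Gamma b) = ennreal (A powr (- b)) * ennreal (A powr b) *
      (\<integral>\<^sup>+x. ennreal (indicator {0..} x * x powr (b - 1) * exp (- (A * x))) \<partial>lborel)"
    by (simp only: mult.assoc)
  moreover have "ennreal (A powr (- b)) * ennreal (A powr b) = 1"
    using assms by (simp add: ennreal_mult'[symmetric] powr_add[symmetric])
  moreover have "ennreal (A powr (- b)) * ennreal (Gamma b) = ennreal (Gamma b * A powr (- b))"
    by (simp add: ennreal_mult'' mult.commute)
  ultimately show ?thesis by simp
qed

lemma nn_integral_gaussian_kernel:
  fixes a :: real
  assumes "a > 0"
  shows "(\<integral>\<^sup>+t. ennreal (exp (- (a * t\<^sup>2))) \<partial>lborel) = ennreal (sqrt (pi / a))"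
proof -
  define \<sigma> where "\<sigma> = sqrt (1 / (2 * a))"
  have \<sigma>: "\<sigma> > 0" "\<sigma>\<^sup>2 = 1 / (2 * a)" using assms by (auto simp: \<sigma>_def)
  have eq: "exp (- (a * t\<^sup>2)) = sqrt (pi / a) * normal_density 0 \<sigma> t" for t
    unfolding normal_density_def \<sigma>(2) using assms by (simp add: real_sqrt_divide field_simps)
  have "(\<integral>\<^sup>+t. ennreal (exp (- (a * t\<^sup>2))) \<partial>lborel)
     = (\<integral>\<^sup>+t. ennreal (sqrt (pi / a)) * ennreal (normal_density 0 \<sigma> t) \<partial>lborel)"
    unfolding eq using assms by (simp add: ennreal_mult')
  also have "\<dots> = ennreal (sqrt (pi / a)) * (\<integral>\<^sup>+t. ennreal (normal_density 0 \<sigma> t) \<partial>lborel)"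
    by (rule nn_integral_cmult) simp
  also have "(\<integral>\<^sup>+t. ennreal (normal_density 0 \<sigma> t) \<partial>lborel) = 1"
    using \<sigma> by (simp add: nn_integral_eq_integral)
  finally show ?thesis by simp
qed

text \<open>
Write the power of \<open>1 + t\<^sup>2 / \<nu>\<close> as a Gamma integral; after exchanging the integrals,
the inner one is Gaussian and the outer one is again a Gamma integral.
\<close>
lemma nn_integral_student_kernel:
  fixes \<nu> :: real
  assumes \<nu>: "\<nu> > 0"
  shows "(\<integral>\<^sup>+t. ennreal ((1 + t\<^sup>2 / \<nu>) powr (- ((\<nu> + 1) / 2))) \<partial>lborel)
    = ennreal (sqrt (\<nu> * pi) * Gamma (\<nu> / 2) / Gamma ((\<nu> + 1) / 2))"
proof -
  define b where "b = (\<nu> + 1) / 2"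
  have b: "b > 0" "Gamma b > 0" using \<nu> by (auto simp: b_def Gamma_real_pos)
  let ?k = "\<lambda>x::real. indicator {0..} x * x powr (b - 1) * exp (- x) :: real"
  have "ennreal (Gamma b) * (\<integral>\<^sup>+t. ennreal ((1 + t\<^sup>2 / \<nu>) powr (- b)) \<partial>lborel)
     = (\<integral>\<^sup>+t. ennreal (Gamma b * (1 + t\<^sup>2 / \<nu>) powr (- b)) \<partial>lborel)"
    using b by (subst nn_integral_cmult[symmetric]) (auto simp: ennreal_mult')
  also have "\<dots> = (\<integral>\<^sup>+t. \<integral>\<^sup>+x. ennreal (indicator {0..} x * x powr (b - 1) * exp (- ((1 + t\<^sup>2 / \<nu>) * x))) \<partial>lborel \<partial>lborel)"
    using b \<nu> by (intro nn_integral_cong nn_integral_Gamma_scaled[symmetric]) (auto intro!: add_pos_nonneg)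
  also have "\<dots> = (\<integral>\<^sup>+x. \<integral>\<^sup>+t. ennreal (indicator {0..} x * x powr (b - 1) * exp (- ((1 + t\<^sup>2 / \<nu>) * x))) \<partial>lborel \<partial>lborel)"
    by (rule lborel_pair.Fubini') simp
  also have "\<dots> = (\<integral>\<^sup>+x. ennreal (sqrt (\<nu> * pi)) *
      ennreal (indicator {0..} x * x powr (\<nu> / 2 - 1) * exp (- (1 * x))) \<partial>lborel)"
  proof (rule nn_integral_cong_AE)
    show "AE x in lborel. (\<integral>\<^sup>+t. ennreal (indicator {0..} x * x powr (b - 1) * exp (- ((1 + t\<^sup>2 / \<nu>) * x))) \<partial>lborel)
      = ennreal (sqrt (\<nu> * pi)) * ennreal (indicator {0..} x * x powr (\<nu> / 2 - 1) * exp (- (1 * x)))"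
      using AE_lborel_singleton[of "0::real"]
    proof eventually_elim
      case (elim x)
      show ?case
      proof (cases "x > 0")
        case True
        have "(\<integral>\<^sup>+t. ennreal (indicator {0..} x * x powr (b - 1) * exp (- ((1 + t\<^sup>2 / \<nu>) * x))) \<partial>lborel)
          = (\<integral>\<^sup>+t. ennreal (?k x) * ennreal (exp (- (x / \<nu> * t\<^sup>2))) \<partial>lborel)"
        proof (rule nn_integral_cong)
          fix t
          have "- ((1 + t\<^sup>2 / \<nu>) * x) = - x + - (x / \<nu> * t\<^sup>2)" by (simp add: algebra_simps)
          then show "ennreal (indicator {0..} x * x powr (b - 1) * exp (- ((1 + t\<^sup>2 / \<nu>) * x)))
            = ennreal (?k x) * ennreal (exp (- (x / \<nu> * t\<^sup>2)))"
            by (simp only: exp_add) (simp add: ennreal_mult'[symmetric] mult.assoc)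
        qed
        also have "\<dots> = ennreal (?k x) * ennreal (sqrt (pi / (x / \<nu>)))"
          using True \<nu> nn_integral_gaussian_kernel[of "x / \<nu>"] by (subst nn_integral_cmult) auto
        also have "\<dots> = ennreal (?k x * sqrt (pi / (x / \<nu>)))"
          using True by (simp add: ennreal_mult'[symmetric])
        also have "?k x * sqrt (pi / (x / \<nu>)) = sqrt (\<nu> * pi) * (indicator {0..} x * x powr (\<nu> / 2 - 1) * exp (- (1 * x)))"
        proof -
          have "x powr (b - 1) = x powr (\<nu> / 2 - 1) * x powr (1 / 2)"
            by (simp add: b_def powr_add[symmetric] add_divide_distrib)
          then show ?thesis using True \<nu>
            by (simp add: powr_half_sqrt real_sqrt_divide real_sqrt_mult)
        qed
        finally show ?thesis using True \<nu> by (simp add: ennreal_mult'[symmetric])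
      next
        case False
        then have "indicator {0..} x = (0::real)" using elim by auto
        then show ?thesis by simp
      qed
    qed
  qed
  also have "\<dots> = ennreal (sqrt (\<nu> * pi)) * ennreal (Gamma (\<nu> / 2) * 1 powr (- (\<nu> / 2)))"
    using \<nu> by (subst nn_integral_cmult) (auto simp: nn_integral_Gamma_scaled[of _ 1, simplified])
  finally have "ennreal (Gamma b) * (\<integral>\<^sup>+t. ennreal ((1 + t\<^sup>2 / \<nu>) powr (- b)) \<partial>lborel)
    = ennreal (sqrt (\<nu> * pi) * Gamma (\<nu> / 2))" using \<nu> by (simp add: ennreal_mult'[symmetric])
  then have "ennreal (1 / Gamma b) * (ennreal (Gamma b) * (\<integral>\<^sup>+t. ennreal ((1 + t\<^sup>2 / \<nu>) powr (- b)) \<partial>lborel))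
    = ennreal (1 / Gamma b) * ennreal (sqrt (\<nu> * pi) * Gamma (\<nu> / 2))" by simp
  then show ?thesis using b
    by (simp add: mult.assoc[symmetric] ennreal_mult'[symmetric]) (simp add: b_def)
qed

text \<open>
For a fixed value of the chi-square variable the ratio is a rescaled normal variable, and its density
at \<open>t\<close>, averaged over that variable, is a tilted moment of the chi-square law.  By
\<open>chi_square_tilt\<close> it equals a constant times the Student kernel.  The constant need not be computed:
the left-hand side has total mass 1, so it is the inverse of the mass of the kernel.
\<close>
lemma student_ratio_law:
  fixes g :: "real \<Rightarrow> ennreal"
  assumes k: "k > 0" and [measurable]: "g \<in> borel_measurable borel"
  shows "(\<integral>\<^sup>+s. \<integral>\<^sup>+u. g (u / sqrt (s / real k)) \<partial>std_normal \<partial>chi_square k)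
    = (\<integral>\<^sup>+t. g t \<partial>student_t_distribution (real k))"
proof -
  interpret chi: prob_space "chi_square k" by (rule prob_space_chi_square)
  interpret P: pair_sigma_finite "chi_square k" lborel by unfold_locales
  define \<nu> where "\<nu> = real k"
  have \<nu>: "\<nu> > 0" using k by (simp add: \<nu>_def)
  define C where "C = (\<integral>\<^sup>+s. ennreal (sqrt (s / \<nu>) / sqrt (2 * pi)) \<partial>chi_square k)"
  let ?K = "\<lambda>t. (1 + t\<^sup>2 / \<nu>) powr (- ((\<nu> + 1) / 2))"
  have ratio: "(\<integral>\<^sup>+s. \<integral>\<^sup>+u. g (u / sqrt (s / \<nu>)) \<partial>std_normal \<partial>chi_square k)
     = C * (\<integral>\<^sup>+t. ennreal (?K t) * g t \<partial>lborel)"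
    if [measurable]: "g \<in> borel_measurable borel" for g :: "real \<Rightarrow> ennreal"
  proof -
    have "(\<integral>\<^sup>+s. \<integral>\<^sup>+u. g (u / sqrt (s / \<nu>)) \<partial>std_normal \<partial>chi_square k)
      = (\<integral>\<^sup>+s. \<integral>\<^sup>+t. ennreal (sqrt (s / \<nu>) * std_normal_density (t * sqrt (s / \<nu>))) * g t \<partial>lborel \<partial>chi_square k)"
    proof (rule nn_integral_cong_AE)
      show "AE s in chi_square k. (\<integral>\<^sup>+u. g (u / sqrt (s / \<nu>)) \<partial>std_normal) =
        (\<integral>\<^sup>+t. ennreal (sqrt (s / \<nu>) * std_normal_density (t * sqrt (s / \<nu>))) * g t \<partial>lborel)"
        using AE_chi_square_pos[OF k]
      proof eventually_elim
        case (elim s)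
        define r where "r = sqrt (s / \<nu>)"
        have r: "r > 0" using elim \<nu> by (simp add: r_def)
        have "(\<integral>\<^sup>+u. g (u / r) \<partial>std_normal) = (\<integral>\<^sup>+u. ennreal (std_normal_density u) * g (u / r) \<partial>lborel)"
          by (simp add: nn_integral_density)
        also have "\<dots> = ennreal r * (\<integral>\<^sup>+t. ennreal (std_normal_density (t * r)) * g t \<partial>lborel)"
          using r by (subst nn_integral_real_affine[where c = r and t = 0]) (auto simp: mult.commute)
        also have "\<dots> = (\<integral>\<^sup>+t. ennreal (r * std_normal_density (t * r)) * g t \<partial>lborel)"
          using r by (subst nn_integral_cmult[symmetric]) (auto simp: ennreal_mult' mult.assoc)
        finally show ?case by (simp only: r_def)
      qed
    qed
    also have "\<dots> = (\<integral>\<^sup>+t. \<integral>\<^sup>+s. ennreal (sqrt (s / \<nu>) * std_normal_density (t * sqrt (s / \<nu>))) * g t \<partial>chi_square k \<partial>lborel)"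
      by (rule P.Fubini'[symmetric]) simp
    also have "\<dots> = (\<integral>\<^sup>+t. C * (ennreal (?K t) * g t) \<partial>lborel)"
    proof (rule nn_integral_cong)
      fix t
      define r where "r = sqrt (1 + t\<^sup>2 / \<nu>)"
      have A: "1 + t\<^sup>2 / \<nu> > 0" using \<nu> by (auto intro!: add_pos_nonneg)
      then have r: "r > 0" "r\<^sup>2 = 1 + t\<^sup>2 / \<nu>" by (auto simp: r_def)
      have "(\<integral>\<^sup>+s. ennreal (sqrt (s / \<nu>) * std_normal_density (t * sqrt (s / \<nu>))) \<partial>chi_square k)
        = (\<integral>\<^sup>+s. ennreal (sqrt (s / \<nu>) / sqrt (2 * pi)) * ennreal (exp (- ((r\<^sup>2 - 1) / 2 * s))) \<partial>chi_square k)"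
      proof (rule nn_integral_cong_AE)
        show "AE s in chi_square k. ennreal (sqrt (s / \<nu>) * std_normal_density (t * sqrt (s / \<nu>)))
          = ennreal (sqrt (s / \<nu>) / sqrt (2 * pi)) * ennreal (exp (- ((r\<^sup>2 - 1) / 2 * s)))"
          using AE_chi_square_pos[OF k]
        proof eventually_elim
          case (elim s)
          have "- ((r\<^sup>2 - 1) / 2 * s) = - (t * sqrt (s / \<nu>))\<^sup>2 / 2"
            using elim \<nu> by (simp add: r(2) power_mult_distrib)
          then show ?case using elim \<nu>
            by (simp only: std_normal_density_def) (simp add: ennreal_mult'[symmetric])
        qed
      qed
      also have "\<dots> = ennreal ((1 / r) ^ k) * (\<integral>\<^sup>+s. ennreal (sqrt (s / r\<^sup>2 / \<nu>) / sqrt (2 * pi)) \<partial>chi_square k)"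
        by (rule chi_square_tilt[OF r(1)]) simp
      also have "(\<integral>\<^sup>+s. ennreal (sqrt (s / r\<^sup>2 / \<nu>) / sqrt (2 * pi)) \<partial>chi_square k)
        = (\<integral>\<^sup>+s. ennreal (1 / r) * ennreal (sqrt (s / \<nu>) / sqrt (2 * pi)) \<partial>chi_square k)"
        using r(1) by (intro nn_integral_cong) (simp add: ennreal_mult'[symmetric] real_sqrt_divide real_sqrt_mult mult.assoc)
      also have "\<dots> = ennreal (1 / r) * C"
        unfolding C_def by (rule nn_integral_cmult) simp
      finally have "(\<integral>\<^sup>+s. ennreal (sqrt (s / \<nu>) * std_normal_density (t * sqrt (s / \<nu>))) \<partial>chi_square k)
        = ennreal ((1 / r) ^ Suc k) * C"
        using r(1) by (simp only: power_Suc2 ennreal_mult' zero_le_power zero_le_divide_1_iff less_imp_le mult.assoc)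
      also have "(1 / r) ^ Suc k = ?K t"
      proof -
        have "- ((\<nu> + 1) / 2) = 1 / 2 * (- real (Suc k))" by (simp add: \<nu>_def field_simps)
        then have "?K t = ((1 + t\<^sup>2 / \<nu>) powr (1 / 2)) powr (- real (Suc k))"
          by (simp only: powr_powr)
        also have "(1 + t\<^sup>2 / \<nu>) powr (1 / 2) = r"
          unfolding r_def using A by (simp add: powr_half_sqrt)
        also have "r powr (- real (Suc k)) = inverse (r ^ Suc k)"
          using r(1) by (simp only: powr_minus powr_realpow)
        also have "\<dots> = (1 / r) ^ Suc k"
          by (simp only: power_one_over inverse_eq_divide)
        finally show ?thesis by (rule sym)
      qed
      finally have I: "(\<integral>\<^sup>+s. ennreal (sqrt (s / \<nu>) * std_normal_density (t * sqrt (s / \<nu>))) \<partial>chi_square k)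
        = ennreal (?K t) * C" .
      show "(\<integral>\<^sup>+s. ennreal (sqrt (s / \<nu>) * std_normal_density (t * sqrt (s / \<nu>))) * g t \<partial>chi_square k)
        = C * (ennreal (?K t) * g t)"
        by (subst nn_integral_multc, simp) (simp only: I mult_ac)
    qed
    also have "\<dots> = C * (\<integral>\<^sup>+t. ennreal (?K t) * g t \<partial>lborel)"
      by (rule nn_integral_cmult) simp
    finally show ?thesis .
  qed
  define G where "G = Gamma ((\<nu> + 1) / 2) / (sqrt (\<nu> * pi) * Gamma (\<nu> / 2))"
  have pos: "Gamma ((\<nu> + 1) / 2) > 0" "Gamma (\<nu> / 2) > 0" using \<nu> by (auto intro!: Gamma_real_pos)
  then have "G > 0" using \<nu> by (simp add: G_def)
  have "1 = C * (\<integral>\<^sup>+t. ennreal (?K t) * 1 \<partial>lborel)"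
    using ratio[of "\<lambda>_. 1"] by simp
  also have "\<dots> = C * ennreal (sqrt (\<nu> * pi) * Gamma (\<nu> / 2) / Gamma ((\<nu> + 1) / 2))"
    by (simp only: mult_1_right nn_integral_student_kernel[OF \<nu>])
  also have "sqrt (\<nu> * pi) * Gamma (\<nu> / 2) / Gamma ((\<nu> + 1) / 2) = 1 / G" by (simp add: G_def)
  finally have one: "C * ennreal (1 / G) = 1" by (rule sym)
  have "ennreal G = C * ennreal (1 / G) * ennreal G" by (simp only: one mult_1_left)
  also have "\<dots> = C * ennreal (1 / G * G)"
    using \<open>G > 0\<close> by (simp only: mult.assoc ennreal_mult' less_imp_le zero_le_divide_1_iff)
  finally have CG: "C = ennreal G" using \<open>G > 0\<close> by simp
  have [measurable]: "student_t_density \<nu> \<in> borel_measurable borel"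
    unfolding student_t_density_def by measurable
  have "(\<integral>\<^sup>+t. g t \<partial>student_t_distribution \<nu>) = (\<integral>\<^sup>+t. ennreal (student_t_density \<nu> t) * g t \<partial>lborel)"
    unfolding student_t_distribution_def by (rule nn_integral_density) simp_all
  also have "\<dots> = (\<integral>\<^sup>+t. C * (ennreal (?K t) * g t) \<partial>lborel)"
  proof (rule nn_integral_cong)
    fix t
    have "student_t_density \<nu> t = G * ?K t" by (simp only: student_t_density_def G_def)
    then show "ennreal (student_t_density \<nu> t) * g t = C * (ennreal (?K t) * g t)"
      using \<open>G > 0\<close> by (simp only: CG ennreal_mult' less_imp_le mult.assoc)
  qed
  also have "\<dots> = C * (\<integral>\<^sup>+t. ennreal (?K t) * g t \<partial>lborel)"
    by (rule nn_integral_cmult) simp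
  finally show ?thesis using ratio[of g] by (simp add: \<nu>_def)
qed

text \<open>
A distribution function without jumps is continuous, so it attains every level in \<open>(0, 1)\<close> and the
infimum that defines the quantile is attained.
\<close>
lemma real_distribution_cdf_quantile:
  assumes "real_distribution D" and no_atoms: "\<And>x. measure D {x} = 0" and u: "0 < u" "u < 1"
  shows "cdf D (quantile D u) = u"
    and "bdd_below {x. u \<le> cdf D x}"
proof -
  interpret real_distribution D by fact
  have cont: "isCont (cdf D) x" for x using isCont_cdf no_atoms by blast
  have "eventually (\<lambda>x. cdf D x < u) at_bot"
    using cdf_lim_at_bot u by (auto dest: order_tendstoD)
  then obtain a where a: "cdf D a < u" by (auto simp: eventually_at_bot_linorder)
  have "eventually (\<lambda>x. u < cdf D x) at_top"
    using cdf_lim_at_top_prob u by (auto dest: order_tendstoD)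
  then obtain b where b: "u < cdf D b" by (auto simp: eventually_at_top_linorder)
  have "a \<le> b" using cdf_nondecreasing[of b a] a b by linarith
  then obtain x where x: "cdf D x = u"
    using IVT'[of "cdf D" a u b] a b cont by (auto intro: continuous_at_imp_continuous_on)
  let ?S = "{x. u \<le> cdf D x}"
  have "a \<le> y" if "y \<in> ?S" for y using cdf_nondecreasing[of y a] a that by force
  then show bdd: "bdd_below ?S" by (rule bdd_belowI)
  have "closed ?S"
    using cont by (intro closed_Collect_le continuous_on_const continuous_at_imp_continuous_on) auto
  then have "quantile D u \<in> ?S"
    unfolding quantile_def using x bdd by (intro closed_contains_Inf) auto
  moreover have "cdf D (quantile D u) \<le> u"
    unfolding x[symmetric] by (rule cdf_nondecreasing) (use x bdd in \<open>auto simp: quantile_def intro: cInf_lower\<close>)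
  ultimately show "cdf D (quantile D u) = u" by simp
qed

lemma
  assumes k: "k > 0"
  shows real_distribution_student_t: "real_distribution (student_t_distribution (real k))"
    and student_t_no_atoms: "measure (student_t_distribution (real k)) {x} = 0"
    and student_t_symmetric: "A \<in> sets borel \<Longrightarrow>
      measure (student_t_distribution (real k)) (uminus -` A) = measure (student_t_distribution (real k)) A"
proof -
  let ?D = "student_t_distribution (real k)"
  have [measurable]: "student_t_density (real k) \<in> borel_measurable borel"
    unfolding student_t_density_def by measurable
  have sets: "sets ?D = sets borel" by (simp add: student_t_distribution_def)
  have space: "space ?D = UNIV" by (simp add: student_t_distribution_def)
  have "emeasure ?D (space ?D) = (\<integral>\<^sup>+t. 1 \<partial>?D)" by simp
  also have "\<dots> = (\<integral>\<^sup>+s. \<integral>\<^sup>+u. 1 \<partial>std_normal \<partial>chi_square k)"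
    by (rule student_ratio_law[OF k, symmetric]) simp
  finally have "emeasure ?D (space ?D) = 1" by simp
  then show "real_distribution ?D"
    by (intro real_distribution.intro real_distribution_axioms.intro prob_spaceI sets)
  have "emeasure ?D {x} = (\<integral>\<^sup>+t. ennreal (student_t_density (real k) t) * indicator {x} t \<partial>lborel)"
    unfolding student_t_distribution_def by (rule emeasure_density) simp_all
  also have "\<dots> = (\<integral>\<^sup>+t. 0 \<partial>(lborel :: real measure))"
    using AE_lborel_singleton[of x] by (intro nn_integral_cong_AE) (auto simp: indicator_def)
  finally show "measure ?D {x} = 0" by (simp add: measure_def)
  show "measure ?D (uminus -` A) = measure ?D A" if [measurable]: "A \<in> sets borel"
  proof -
    have "emeasure ?D A = (\<integral>\<^sup>+t. ennreal (student_t_density (real k) t) * indicator A t \<partial>lborel)"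
      unfolding student_t_distribution_def by (rule emeasure_density) simp_all
    also have "\<dots> = (\<integral>\<^sup>+t. ennreal (student_t_density (real k) t) * indicator (uminus -` A) t \<partial>lborel)"
      by (subst nn_integral_real_affine[where c = "-1" and t = 0])
         (auto simp: student_t_density_def indicator_def)
    also have "\<dots> = emeasure ?D (uminus -` A)"
      unfolding student_t_distribution_def
      by (rule emeasure_density[symmetric]) (auto intro!: measurable_sets_borel[where M = borel])
    finally show ?thesis by (simp add: measure_def)
  qed
qed

text \<open>
By symmetry the Student distribution function is \<open>1 / 2\<close> at 0, so the \<open>t / 2\<close> quantile is not
positive and the two tails beyond it have mass \<open>t / 2\<close> each.
\<close>
lemma
  assumes n: "n \<ge> 2" and t: "0 < t" "t \<le> 1"
  shows t_quantile_nonpos: "t_quantile n (t / 2) \<le> 0"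
    and two_sided_t_tail: "emeasure (student_t_distribution (real (n - 1))) {x. \<bar>t_quantile n (t / 2)\<bar> < \<bar>x\<bar>} = ennreal t"
proof -
  define D where "D = student_t_distribution (real (n - 1))"
  define q where "q = t_quantile n (t / 2)"
  have k: "n - 1 > 0" using n by simp
  interpret D: real_distribution D unfolding D_def by (rule real_distribution_student_t[OF k])
  have no_atoms: "measure D {x} = 0" for x unfolding D_def by (rule student_t_no_atoms[OF k])
  have sym: "measure D {- x <..} = measure D {..<x}" for x
  proof -
    have "uminus -` {..<x} = {- x <..}" by auto
    then show ?thesis using student_t_symmetric[OF k, of "{..<x}"] by (simp add: D_def)
  qed
  have less: "measure D {..<x} = cdf D x" for x
  proof -
    have "measure D {..x} = measure D ({..<x} \<union> {x})" by (intro arg_cong[where f = "measure D"]) auto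
    also have "\<dots> = measure D {..<x} + measure D {x}" by (rule D.finite_measure_Union) auto
    finally show ?thesis by (simp add: cdf_def no_atoms)
  qed
  have q_def': "q = quantile D (t / 2)"
    using n by (simp add: q_def t_quantile_def D_def of_nat_diff)
  note quant = real_distribution_cdf_quantile[OF D.real_distribution_axioms no_atoms, of "t / 2"]
  have cdf_q: "cdf D q = t / 2" unfolding q_def' using t by (intro quant) auto
  have "1 = measure D (space D)" by (rule D.prob_space[symmetric])
  also have "space D = {..0} \<union> {- 0 <..}" by auto
  also have "measure D \<dots> = measure D {..0} + measure D {- 0 <..}" by (rule D.finite_measure_Union) auto
  finally have "cdf D 0 = 1 / 2" using sym[of 0] less[of 0] by (simp add: cdf_def)
  then show q0: "t_quantile n (t / 2) \<le> 0"
    unfolding q_def[symmetric] unfolding q_def' quantile_def using t quant(2)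
    by (intro cInf_lower) auto
  have "{x. \<bar>q\<bar> < \<bar>x\<bar>} = {..<q} \<union> {- q <..}" using q0 by (auto simp: q_def)
  then have "measure D {x. \<bar>q\<bar> < \<bar>x\<bar>} = measure D {..<q} + measure D {- q <..}"
    using q0 by (simp add: q_def) (rule D.finite_measure_Union, auto)
  also have "\<dots> = t" by (simp add: sym less cdf_q)
  finally show "emeasure (student_t_distribution (real (n - 1))) {x. \<bar>t_quantile n (t / 2)\<bar> < \<bar>x\<bar>} = ennreal t"
    unfolding D_def[symmetric] q_def[symmetric] D.emeasure_eq_measure by simp
qed

section \<open>Rejection probabilities\<close>

interpretation std_normal: real_distribution std_normal
  by unfold_locales simp

lemma std_normal_no_atoms: "measure std_normal {x} = 0"
proof -
  have "emeasure std_normal {x} = (\<integral>\<^sup>+t. ennreal (std_normal_density t) * indicator {x} t \<partial>lborel)"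
    by (rule emeasure_density) simp_all
  also have "\<dots> = (\<integral>\<^sup>+t. 0 \<partial>(lborel :: real measure))"
    using AE_lborel_singleton[of x] by (intro nn_integral_cong_AE) (auto simp: indicator_def)
  finally show ?thesis by (simp add: measure_def)
qed

lemma std_normal_cdf_bounds: "0 \<le> std_normal_cdf x" "std_normal_cdf x \<le> 1"
  by (simp_all add: std_normal_cdf_def std_normal.cdf_nonneg std_normal.cdf_bounded_prob)

lemma std_normal_cdf_mono: "x \<le> y \<Longrightarrow> std_normal_cdf x \<le> std_normal_cdf y"
  by (simp add: std_normal_cdf_def std_normal.cdf_nondecreasing)

lemma measurable_std_normal_cdf [measurable]: "std_normal_cdf \<in> borel_measurable borel"
  by (rule borel_measurable_mono) (simp add: mono_def std_normal_cdf_mono)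

lemma std_normal_lower_tail: "emeasure std_normal {..<c} = ennreal (std_normal_cdf c)"
proof -
  have "measure std_normal {..c} = measure std_normal ({..<c} \<union> {c})"
    by (intro arg_cong[where f = "measure std_normal"]) auto
  also have "\<dots> = measure std_normal {..<c} + measure std_normal {c}"
    by (rule std_normal.finite_measure_Union) auto
  finally show ?thesis
    by (simp add: std_normal_cdf_def cdf_def std_normal_no_atoms std_normal.emeasure_eq_measure)
qed

lemma std_normal_upper_tail: "emeasure std_normal {c<..} = ennreal (std_normal_cdf (- c))"
proof -
  have "emeasure std_normal {c<..} = emeasure std_normal {..<- c}"
  proof -
    have "emeasure std_normal {c<..} = (\<integral>\<^sup>+t. ennreal (std_normal_density t) * indicator {c<..} t \<partial>lborel)"
      by (rule emeasure_density) simp_all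
    also have "\<dots> = (\<integral>\<^sup>+t. ennreal (std_normal_density t) * indicator {..<- c} t \<partial>lborel)"
      by (subst nn_integral_real_affine[where c = "-1" and t = 0])
         (auto simp: std_normal_density_def indicator_def intro!: nn_integral_cong)
    also have "\<dots> = emeasure std_normal {..<- c}"
      by (rule emeasure_density[symmetric]) simp_all
    finally show ?thesis .
  qed
  also have "\<dots> = ennreal (std_normal_cdf (- c))" by (rule std_normal_lower_tail)
  finally show ?thesis .
qed

lemma std_normal_two_sided_tail:
  assumes "c \<ge> 0"
  shows "emeasure std_normal {u. c < \<bar>m + u\<bar>} = ennreal (std_normal_cdf (- c + m) + std_normal_cdf (- c - m))"
proof -
  have "{u. c < \<bar>m + u\<bar>} = {c - m<..} \<union> {..<- c - m}" using assms by auto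
  moreover have "emeasure std_normal ({c - m<..} \<union> {..<- c - m})
      = emeasure std_normal {c - m<..} + emeasure std_normal {..<- c - m}"
    using assms by (intro plus_emeasure[symmetric]) auto
  ultimately show ?thesis
    by (simp add: std_normal_upper_tail std_normal_lower_tail ennreal_plus std_normal_cdf_bounds)
qed

text \<open>
For a fixed value of the sample standard deviation the test rejects when a normal variable with mean
\<open>sqrt n * m\<close> leaves an interval symmetric about 0.  Observations are written as \<open>m + z i\<close> with
standard normal \<open>z i\<close>, so that the sample standard deviation does not depend on \<open>m\<close>.
\<close>
lemma rejection_prob_eq_mixture:
  assumes n: "n \<ge> 2" and t: "0 < t" "t \<le> 1"
  defines "q \<equiv> t_quantile n (t / 2)"
  shows "emeasure (\<Pi>\<^sub>M i\<in>{..<n}. std_normal) {z \<in> space (\<Pi>\<^sub>M i\<in>{..<n}. std_normal). rejects n t (\<lambda>i. m + z i)}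
      = (\<integral>\<^sup>+s. ennreal (std_normal_cdf (q * sqrt (s / real (n - 1)) + sqrt n * m)
           + std_normal_cdf (q * sqrt (s / real (n - 1)) - sqrt n * m)) \<partial>chi_square (n - 1))"
proof -
  note [measurable] = measurable_sample_functions
  let ?P = "\<Pi>\<^sub>M i\<in>{..<n}. std_normal"
  have n0: "n > 0" "n - 1 > 0" using n by auto
  define h :: "real \<times> real \<Rightarrow> ennreal" where
    "h v = indicator {v. \<bar>q\<bar> < \<bar>(sqrt n * m + fst v) / snd v\<bar>} v" for v
  have [measurable]: "h \<in> borel_measurable (borel \<Otimes>\<^sub>M borel)" unfolding h_def by measurable
  have "emeasure ?P {z \<in> space ?P. rejects n t (\<lambda>i. m + z i)}
      = (\<integral>\<^sup>+z. indicator {z \<in> space ?P. rejects n t (\<lambda>i. m + z i)} z \<partial>?P)"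
    by (rule nn_integral_indicator[symmetric]) measurable
  also have "\<dots> = (\<integral>\<^sup>+z. h (sqrt n * sample_mean n z, sample_sd n z) \<partial>?P)"
    using n0 by (intro nn_integral_cong)
      (simp add: h_def indicator_def rejects_def t_stat_def sample_mean_shift sample_sd_shift q_def distrib_left)
  also have "\<dots> = (\<integral>\<^sup>+s. \<integral>\<^sup>+u. h (u, sqrt (s / real (n - 1))) \<partial>std_normal \<partial>chi_square (n - 1))"
    by (rule sample_mean_sd_law[OF n0(1)]) simp
  also have "\<dots> = (\<integral>\<^sup>+s. ennreal (std_normal_cdf (q * sqrt (s / real (n - 1)) + sqrt n * m)
           + std_normal_cdf (q * sqrt (s / real (n - 1)) - sqrt n * m)) \<partial>chi_square (n - 1))"
  proof (rule nn_integral_cong_AE)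
    show "AE s in chi_square (n - 1). (\<integral>\<^sup>+u. h (u, sqrt (s / real (n - 1))) \<partial>std_normal) =
      ennreal (std_normal_cdf (q * sqrt (s / real (n - 1)) + sqrt n * m)
           + std_normal_cdf (q * sqrt (s / real (n - 1)) - sqrt n * m))"
      using AE_chi_square_pos[OF n0(2)]
    proof eventually_elim
      case (elim s)
      define r where "r = sqrt (s / real (n - 1))"
      have r: "r > 0" using elim n0 by (simp add: r_def)
      have q: "q \<le> 0" using t_quantile_nonpos[OF n t] by (simp only: q_def)
      have "(\<integral>\<^sup>+u. h (u, r) \<partial>std_normal) = (\<integral>\<^sup>+u. indicator {u. \<bar>q\<bar> * r < \<bar>sqrt n * m + u\<bar>} u \<partial>std_normal)"
        using r by (intro nn_integral_cong) (simp add: h_def indicator_def pos_less_divide_eq)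
      also have "\<dots> = emeasure std_normal {u. \<bar>q\<bar> * r < \<bar>sqrt n * m + u\<bar>}"
        by (rule nn_integral_indicator) simp
      also have "\<dots> = ennreal (std_normal_cdf (q * r + sqrt n * m) + std_normal_cdf (q * r - sqrt n * m))"
        using r q by (subst std_normal_two_sided_tail) (auto simp: mult_le_0_iff)
      finally show ?case by (simp add: r_def)
    qed
  qed
  finally show ?thesis .
qed

lemma rejection_prob_eq_expectation:
  assumes n: "n \<ge> 2" and t: "0 < t" "t \<le> 1"
  defines "q \<equiv> t_quantile n (t / 2)"
  shows "emeasure (\<Pi>\<^sub>M i\<in>{..<n}. std_normal) {z \<in> space (\<Pi>\<^sub>M i\<in>{..<n}. std_normal). rejects n t (\<lambda>i. m + z i)}
      = (\<integral>\<^sup>+z. ennreal (std_normal_cdf (q * sample_sd n (\<lambda>i. m + z i) + sqrt n * m)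
           + std_normal_cdf (q * sample_sd n (\<lambda>i. m + z i) - sqrt n * m)) \<partial>(\<Pi>\<^sub>M i\<in>{..<n}. std_normal))"
proof -
  note [measurable] = measurable_sample_functions
  have n0: "n > 0" using n by auto
  show ?thesis
    unfolding rejection_prob_eq_mixture[OF n t, folded q_def] sample_sd_shift[OF n0]
    using sample_mean_sd_law[OF n0, of "\<lambda>v. ennreal (std_normal_cdf (q * snd v + sqrt n * m)
           + std_normal_cdf (q * snd v - sqrt n * m))"] by simp
qed

lemma null_rejection_prob:
  assumes n: "n \<ge> 2" and t: "0 < t" "t \<le> 1"
  shows "emeasure (\<Pi>\<^sub>M i\<in>{..<n}. std_normal) {z \<in> space (\<Pi>\<^sub>M i\<in>{..<n}. std_normal). rejects n t z} = ennreal t"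
proof -
  note [measurable] = measurable_sample_functions
  let ?P = "\<Pi>\<^sub>M i\<in>{..<n}. std_normal"
  let ?q = "t_quantile n (t / 2)"
  have n0: "n > 0" "n - 1 > 0" using n by auto
  let ?A = "{x. \<bar>?q\<bar> < \<bar>x\<bar>}"
  have "emeasure ?P {z \<in> space ?P. rejects n t z} = (\<integral>\<^sup>+z. indicator {z \<in> space ?P. rejects n t z} z \<partial>?P)"
    by (rule nn_integral_indicator[symmetric]) measurable
  also have "\<dots> = (\<integral>\<^sup>+z. indicator ?A (sqrt n * sample_mean n z / sample_sd n z) \<partial>?P)"
    by (intro nn_integral_cong) (simp add: indicator_def rejects_def t_stat_def)
  also have "\<dots> = (\<integral>\<^sup>+s. \<integral>\<^sup>+u. indicator ?A (u / sqrt (s / real (n - 1))) \<partial>std_normal \<partial>chi_square (n - 1))"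
    using sample_mean_sd_law[OF n0(1), of "\<lambda>v. indicator ?A (fst v / snd v)"] by simp
  also have "\<dots> = (\<integral>\<^sup>+x. indicator ?A x \<partial>student_t_distribution (real (n - 1)))"
    by (rule student_ratio_law[OF n0(2)]) simp
  also have "\<dots> = emeasure (student_t_distribution (real (n - 1))) ?A"
    by (rule nn_integral_indicator) (simp add: student_t_distribution_def)
  also have "\<dots> = ennreal t" by (rule two_sided_t_tail[OF n t])
  finally show ?thesis .
qed

text \<open>
For \<open>m = 0\<close> both tails have equal mass, so each of them accounts for \<open>t / 2\<close>.  Moving the mean
away from 0 can only enlarge the tail on that side.
\<close>
lemma rejection_prob_lower_bound:
  assumes n: "n \<ge> 2" and t: "0 < t" "t \<le> 1"
  shows "ennreal (t / 2) \<le>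
    emeasure (\<Pi>\<^sub>M i\<in>{..<n}. std_normal) {z \<in> space (\<Pi>\<^sub>M i\<in>{..<n}. std_normal). rejects n t (\<lambda>i. m + z i)}"
proof -
  define f where "f s = t_quantile n (t / 2) * sqrt (s / real (n - 1))" for s
  have [measurable]: "f \<in> borel_measurable borel" unfolding f_def by measurable
  have "ennreal t = (\<integral>\<^sup>+s. ennreal (std_normal_cdf (f s) + std_normal_cdf (f s)) \<partial>chi_square (n - 1))"
    using null_rejection_prob[OF n t] rejection_prob_eq_mixture[OF n t, of 0] by (simp add: f_def)
  also have "\<dots> \<le> (\<integral>\<^sup>+s. ennreal 2 * ennreal (std_normal_cdf (f s + sqrt n * m) + std_normal_cdf (f s - sqrt n * m)) \<partial>chi_square (n - 1))"
  proof (rule nn_integral_mono)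
    fix s
    have "std_normal_cdf (f s) \<le> std_normal_cdf (f s + sqrt n * m) + std_normal_cdf (f s - sqrt n * m)"
    proof (cases "m \<ge> 0")
      case True
      then show ?thesis using std_normal_cdf_mono[of "f s" "f s + sqrt n * m"]
          std_normal_cdf_bounds(1)[of "f s - sqrt n * m"] by simp
    next
      case False
      then have "sqrt n * m \<le> 0" by (simp add: mult_nonneg_nonpos)
      then show ?thesis using std_normal_cdf_mono[of "f s" "f s - sqrt n * m"]
          std_normal_cdf_bounds(1)[of "f s + sqrt n * m"] by simp
    qed
    then have "std_normal_cdf (f s) + std_normal_cdf (f s)
        \<le> 2 * (std_normal_cdf (f s + sqrt n * m) + std_normal_cdf (f s - sqrt n * m))" by simp
    then have "ennreal (std_normal_cdf (f s) + std_normal_cdf (f s))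
        \<le> ennreal (2 * (std_normal_cdf (f s + sqrt n * m) + std_normal_cdf (f s - sqrt n * m)))"
      by (rule ennreal_leI)
    also have "\<dots> = ennreal 2 * ennreal (std_normal_cdf (f s + sqrt n * m) + std_normal_cdf (f s - sqrt n * m))"
      by (rule ennreal_mult') simp
    finally show "ennreal (std_normal_cdf (f s) + std_normal_cdf (f s))
        \<le> ennreal 2 * ennreal (std_normal_cdf (f s + sqrt n * m) + std_normal_cdf (f s - sqrt n * m))" .
  qed
  also have "\<dots> = ennreal 2 * emeasure (\<Pi>\<^sub>M i\<in>{..<n}. std_normal)
      {z \<in> space (\<Pi>\<^sub>M i\<in>{..<n}. std_normal). rejects n t (\<lambda>i. m + z i)}"
    unfolding rejection_prob_eq_mixture[OF n t] f_def[symmetric] by (rule nn_integral_cmult) simp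
  finally have le: "ennreal t \<le> ennreal 2 * emeasure (\<Pi>\<^sub>M i\<in>{..<n}. std_normal)
      {z \<in> space (\<Pi>\<^sub>M i\<in>{..<n}. std_normal). rejects n t (\<lambda>i. m + z i)}" .
  have "ennreal (t / 2) = ennreal (1 / 2) * ennreal t" by (subst ennreal_mult'[symmetric]) simp_all
  also have "\<dots> \<le> ennreal (1 / 2) * (ennreal 2 * emeasure (\<Pi>\<^sub>M i\<in>{..<n}. std_normal)
      {z \<in> space (\<Pi>\<^sub>M i\<in>{..<n}. std_normal). rejects n t (\<lambda>i. m + z i)})"
    using le by (rule mult_left_mono) simp
  also have "\<dots> = (ennreal (1 / 2) * ennreal 2) * emeasure (\<Pi>\<^sub>M i\<in>{..<n}. std_normal)
      {z \<in> space (\<Pi>\<^sub>M i\<in>{..<n}. std_normal). rejects n t (\<lambda>i. m + z i)}"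
    by (simp only: mult.assoc)
  also have "ennreal (1 / 2) * ennreal 2 = 1" by (subst ennreal_mult'[symmetric]) simp_all
  finally show ?thesis by simp
qed

section \<open>Weakly correlated coordinates are almost independent\<close>

lemma integral_unit_interval:
  fixes h :: "'a \<Rightarrow> real"
  assumes "prob_space M" "\<And>x. 0 \<le> h x" "\<And>x. h x \<le> 1"
  shows "0 \<le> (\<integral>x. h x \<partial>M)" "(\<integral>x. h x \<partial>M) \<le> 1"
proof -
  interpret prob_space M by fact
  show "0 \<le> (\<integral>x. h x \<partial>M)" using assms(2) by simp
  show "(\<integral>x. h x \<partial>M) \<le> 1"
  proof (cases "integrable M h")
    case True
    then show ?thesis using assms(3) by (intro integral_le_const) auto
  qed (simp add: not_integrable_integral_eq)
qed

text \<open>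
The joint density of a centred normal variable and a second one whose conditional mean is \<open>c\<close> times
the first.  Both the bivariate normal density and, up to a constant, its chi-square integrand have
this form.
\<close>
lemma conditional_normal_density_mass:
  fixes a b c :: real
  assumes "a > 0" "b > 0"
  shows "has_bochner_integral (lborel \<Otimes>\<^sub>M lborel)
    (\<lambda>z. normal_density 0 a (fst z) * normal_density (c * fst z) b (snd z)) 1"
proof (rule has_bochner_integral_nn_integral)
  have [measurable]: "(\<lambda>z::real\<times>real. normal_density (c * fst z) b (snd z)) \<in> borel_measurable (borel \<Otimes>\<^sub>M borel)"
    unfolding normal_density_def by measurable
  show "(\<lambda>z. normal_density 0 a (fst z) * normal_density (c * fst z) b (snd z)) \<in> borel_measurable (lborel \<Otimes>\<^sub>M lborel)"
    by measurable
  have "(\<integral>\<^sup>+z. ennreal (normal_density 0 a (fst z) * normal_density (c * fst z) b (snd z)) \<partial>(lborel \<Otimes>\<^sub>M lborel))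
      = (\<integral>\<^sup>+x. \<integral>\<^sup>+y. ennreal (normal_density 0 a x * normal_density (c * x) b y) \<partial>lborel \<partial>lborel)"
    by (subst lborel.nn_integral_fst[symmetric]) simp_all
  also have "\<dots> = (\<integral>\<^sup>+x. ennreal (normal_density 0 a x) \<partial>lborel)"
  proof (rule nn_integral_cong)
    fix x
    have "(\<integral>\<^sup>+y. ennreal (normal_density 0 a x * normal_density (c * x) b y) \<partial>lborel)
       = (\<integral>\<^sup>+y. ennreal (normal_density 0 a x) * ennreal (normal_density (c * x) b y) \<partial>lborel)"
      by (simp add: ennreal_mult')
    also have "\<dots> = ennreal (normal_density 0 a x) * (\<integral>\<^sup>+y. ennreal (normal_density (c * x) b y) \<partial>lborel)"
      by (rule nn_integral_cmult) simp
    also have "(\<integral>\<^sup>+y. ennreal (normal_density (c * x) b y) \<partial>lborel) = 1"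
      using assms by (simp add: nn_integral_eq_integral)
    finally show "(\<integral>\<^sup>+y. ennreal (normal_density 0 a x * normal_density (c * x) b y) \<partial>lborel)
      = ennreal (normal_density 0 a x)" by simp
  qed
  also have "\<dots> = 1" using assms by (simp add: nn_integral_eq_integral)
  finally show "(\<integral>\<^sup>+z. ennreal (normal_density 0 a (fst z) * normal_density (c * fst z) b (snd z)) \<partial>(lborel \<Otimes>\<^sub>M lborel)) = ennreal 1"
    by simp
qed simp_all

text \<open>
For \<open>\<bar>\<rho>\<bar> < 1\<close>, the density of \<open>correlated_pair \<rho>\<close>, factorized into a marginal and a conditional density.
\<close>
definition pair_density :: "real \<Rightarrow> real \<times> real \<Rightarrow> real" where
  "pair_density \<rho> z = std_normal_density (fst z) * normal_density (\<rho> * fst z) (sqrt (1 - \<rho>\<^sup>2)) (snd z)"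

lemma measurable_pair_density [measurable]: "pair_density \<rho> \<in> borel_measurable (borel \<Otimes>\<^sub>M borel)"
  unfolding pair_density_def normal_density_def by measurable

lemma pair_density_mass:
  "\<rho>\<^sup>2 < 1 \<Longrightarrow> has_bochner_integral (lborel \<Otimes>\<^sub>M lborel) (pair_density \<rho>) 1"
  unfolding pair_density_def by (rule conditional_normal_density_mass) simp_all

text \<open>
Completing the square: the integrand \<open>p\<^sup>2 / q\<close> of the chi-square distance between the correlated
density \<open>p\<close> and the independent density \<open>q\<close> is itself a probability density divided by \<open>1 - \<rho>\<^sup>2\<close>.
Its marginal and conditional standard deviations \<open>\<tau>\<close> and \<open>l\<close> satisfy \<open>\<tau> * l = 1\<close>.
\<close>
lemma pair_density_square:
  fixes \<rho> :: real
  assumes "\<rho>\<^sup>2 < 1"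
  defines "\<tau> \<equiv> sqrt ((1 + \<rho>\<^sup>2) / (1 - \<rho>\<^sup>2))" and "\<kappa> \<equiv> 2 * \<rho> / (1 + \<rho>\<^sup>2)"
    and "l \<equiv> sqrt ((1 - \<rho>\<^sup>2) / (1 + \<rho>\<^sup>2))"
  shows "(pair_density \<rho> (x, y))\<^sup>2 =
    pair_density 0 (x, y) * (normal_density 0 \<tau> x * normal_density (\<kappa> * x) l y / (1 - \<rho>\<^sup>2))"
proof -
  define s where "s = 1 - \<rho>\<^sup>2"
  define r where "r = 1 + \<rho>\<^sup>2"
  have s: "s > 0" using assms by (simp add: s_def)
  have r: "r > 0" by (simp add: r_def add_pos_nonneg)
  have \<tau>2: "\<tau>\<^sup>2 = r / s" and l2: "l\<^sup>2 = s / r" using s r by (auto simp: \<tau>_def l_def s_def r_def)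
  have sq: "sqrt (2 * pi * (r / s)) * sqrt (2 * pi * (s / r)) = 2 * pi"
    using s r by (simp add: real_sqrt_mult[symmetric]) (simp add: power2_eq_square[symmetric] real_sqrt_mult)
  have expo: "- x\<^sup>2 + (- (y - \<rho> * x)\<^sup>2 / s) = - x\<^sup>2 / 2 + - y\<^sup>2 / 2 + (- x\<^sup>2 / (2 * (r / s)) + - (y - \<kappa> * x)\<^sup>2 / (2 * (s / r)))"
  proof -
    have \<kappa>: "\<kappa> = 2 * \<rho> / r" by (simp add: \<kappa>_def r_def)
    have "(y - \<kappa> * x)\<^sup>2 / (2 * (s / r)) = (r * y - 2 * \<rho> * x)\<^sup>2 / (2 * s * r)"
      unfolding \<kappa> using s r by (simp add: field_simps power2_eq_square)
    then have "- x\<^sup>2 / 2 + - y\<^sup>2 / 2 + (- x\<^sup>2 / (2 * (r / s)) + - (y - \<kappa> * x)\<^sup>2 / (2 * (s / r)))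
       = - ((x\<^sup>2 + y\<^sup>2) * s * r + s\<^sup>2 * x\<^sup>2 + (r * y - 2 * \<rho> * x)\<^sup>2) / (2 * s * r)"
      using s r by (simp add: divide_simps) (simp add: power2_eq_square algebra_simps)
    also have "(x\<^sup>2 + y\<^sup>2) * s * r + s\<^sup>2 * x\<^sup>2 + (r * y - 2 * \<rho> * x)\<^sup>2 = 2 * r * (s * x\<^sup>2 + (y - \<rho> * x)\<^sup>2)"
      unfolding s_def r_def by (simp add: power2_eq_square algebra_simps)
    also have "- (2 * r * (s * x\<^sup>2 + (y - \<rho> * x)\<^sup>2)) / (2 * s * r) = - x\<^sup>2 + (- (y - \<rho> * x)\<^sup>2 / s)"
      using s r by (simp add: divide_simps)
    finally show ?thesis by simp
  qed
  have "(pair_density \<rho> (x, y))\<^sup>2 = exp (- x\<^sup>2 + (- (y - \<rho> * x)\<^sup>2 / s)) / (2 * pi * (2 * pi * s))"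
    using s by (simp only: exp_add) (simp add: pair_density_def normal_density_def power_mult_distrib
        power_divide s_def[symmetric] exp_double[symmetric])
  also have "\<dots> = pair_density 0 (x, y) * (normal_density 0 \<tau> x * normal_density (\<kappa> * x) l y / s)"
    unfolding expo pair_density_def normal_density_def \<tau>2 l2 using s r sq
    by (simp only: exp_add) simp
  finally show ?thesis by (simp add: s_def)
qed

text \<open>
By \<open>pair_density_square\<close> the chi-square distance is \<open>\<rho>\<^sup>2 / (1 - \<rho>\<^sup>2)\<close>.  The pointwise inequality
\<open>\<bar>p - q\<bar> \<le> \<bar>\<rho>\<bar> / 2 * q + (p - q)\<^sup>2 / (2 * \<bar>\<rho>\<bar> * q)\<close> turns it into a bound on the total variation
that is linear in \<open>\<bar>\<rho>\<bar>\<close>.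
\<close>
lemma pair_density_L1:
  fixes \<rho> :: real
  assumes "\<bar>\<rho>\<bar> \<le> 1 / 2"
  shows "(\<integral>z. \<bar>pair_density \<rho> z - pair_density 0 z\<bar> \<partial>(lborel \<Otimes>\<^sub>M lborel)) \<le> 2 * \<bar>\<rho>\<bar>"
proof (cases "\<rho> = 0")
  case True
  then show ?thesis by simp
next
  case False
  have "\<bar>\<rho>\<bar>\<^sup>2 \<le> (1 / 2)\<^sup>2" using assms by (intro power_mono) auto
  then have \<rho>2: "\<rho>\<^sup>2 \<le> 1 / 4" by (simp add: power2_eq_square)
  define s where "s = 1 - \<rho>\<^sup>2"
  have s: "s \<ge> 3 / 4" "s > 0" using \<rho>2 by (auto simp: s_def)
  define \<tau> where "\<tau> = sqrt ((1 + \<rho>\<^sup>2) / (1 - \<rho>\<^sup>2))"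
  define \<kappa> where "\<kappa> = 2 * \<rho> / (1 + \<rho>\<^sup>2)"
  define l where "l = sqrt ((1 - \<rho>\<^sup>2) / (1 + \<rho>\<^sup>2))"
  define K where "K z = normal_density 0 \<tau> (fst z) * normal_density (\<kappa> * fst z) l (snd z)" for z :: "real \<times> real"
  let ?L = "lborel \<Otimes>\<^sub>M lborel :: (real \<times> real) measure"
  let ?p = "pair_density \<rho>" and ?q = "pair_density 0"
  have p: "has_bochner_integral ?L ?p 1" and q: "has_bochner_integral ?L ?q 1"
    using \<rho>2 by (auto intro: pair_density_mass)
  have pos: "0 < \<tau>" "0 < l" unfolding \<tau>_def l_def using s
    by (auto simp: s_def intro!: divide_pos_pos add_pos_nonneg)
  have K: "has_bochner_integral ?L K 1"
    unfolding K_def using pos by (rule conditional_normal_density_mass)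
  \<comment> \<open>the right-hand side of that inequality, with the square expanded\<close>
  define B where "B z = \<bar>\<rho>\<bar> / 2 * ?q z + 1 / (2 * \<bar>\<rho>\<bar>) * (K z / s - 2 * ?p z + ?q z)" for z
  have B: "has_bochner_integral ?L B (\<bar>\<rho>\<bar> / 2 * 1 + 1 / (2 * \<bar>\<rho>\<bar>) * (1 / s - 2 * 1 + 1))"
    unfolding B_def
    by (intro has_bochner_integral_add has_bochner_integral_mult_right has_bochner_integral_diff
        has_bochner_integral_divide K p q)
  have le: "\<bar>?p z - ?q z\<bar> \<le> B z" for z
  proof -
    have q0: "?q z > 0" by (simp add: pair_density_def normal_density_pos)
    have sq: "(?p z)\<^sup>2 = ?q z * (K z / s)"
      using pair_density_square[of \<rho> "fst z" "snd z"] \<rho>2 by (simp add: K_def \<tau>_def \<kappa>_def l_def s_def)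
    have chi: "(?p z - ?q z)\<^sup>2 = ?q z * (K z / s - 2 * ?p z + ?q z)"
      unfolding power2_diff sq by (simp add: power2_eq_square algebra_simps)
    define d where "d = \<bar>?p z - ?q z\<bar>"
    have d2: "d\<^sup>2 / ?q z = K z / s - 2 * ?p z + ?q z" using q0 chi by (simp add: d_def)
    \<comment> \<open>arithmetic-geometric mean inequality, weighted by \<open>\<bar>\<rho>\<bar>\<close> to balance the two terms\<close>
    have "0 \<le> (d - \<bar>\<rho>\<bar> * ?q z)\<^sup>2 / (2 * \<bar>\<rho>\<bar> * ?q z)" using q0 by simp
    also have "\<dots> = \<bar>\<rho>\<bar> / 2 * ?q z + 1 / (2 * \<bar>\<rho>\<bar>) * (d\<^sup>2 / ?q z) - d"
      using q0 False by (simp add: divide_simps) (simp add: power2_eq_square algebra_simps)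
    finally show ?thesis unfolding B_def d2[symmetric] by (simp add: d_def)
  qed
  have "(\<integral>z. \<bar>?p z - ?q z\<bar> \<partial>?L) \<le> (\<integral>z. B z \<partial>?L)"
    using p q B by (intro integral_mono le integrable_abs Bochner_Integration.integrable_diff)
      (auto dest: integrable.intros)
  also have "\<dots> = \<bar>\<rho>\<bar> / 2 + 1 / (2 * \<bar>\<rho>\<bar>) * (1 / s - 1)"
    using has_bochner_integral_integral_eq[OF B] by simp
  also have "1 / s - 1 = \<rho>\<^sup>2 / s" using s by (simp add: s_def field_simps)
  also have "1 / (2 * \<bar>\<rho>\<bar>) * (\<rho>\<^sup>2 / s) = \<bar>\<rho>\<bar> * (1 / (2 * s))"
    using False s by (simp add: field_simps power2_eq_square abs_if)
  also have "\<dots> \<le> \<bar>\<rho>\<bar> * (3 / 2)" using s by (intro mult_left_mono) (auto simp: field_simps)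
  finally show ?thesis by simp
qed

lemma integral_correlated_pair:
  fixes h :: "real \<times> real \<Rightarrow> real"
  assumes \<rho>: "\<rho>\<^sup>2 < 1" and [measurable]: "h \<in> borel_measurable (borel \<Otimes>\<^sub>M borel)" and h0: "\<And>z. 0 \<le> h z"
  shows "(\<integral>z. h (fst z, \<rho> * fst z + sqrt (1 - \<rho>\<^sup>2) * snd z) \<partial>(std_normal \<Otimes>\<^sub>M std_normal))
     = (\<integral>z. pair_density \<rho> z * h z \<partial>(lborel \<Otimes>\<^sub>M lborel))"
proof -
  define s where "s = sqrt (1 - \<rho>\<^sup>2)"
  have s: "s > 0" using \<rho> by (simp add: s_def)
  have "(\<integral>\<^sup>+z. ennreal (h (fst z, \<rho> * fst z + s * snd z)) \<partial>(std_normal \<Otimes>\<^sub>M std_normal))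
      = (\<integral>\<^sup>+x. \<integral>\<^sup>+y. ennreal (h (x, \<rho> * x + s * y)) \<partial>std_normal \<partial>std_normal)"
    by (subst std_normal.nn_integral_fst[symmetric]) simp_all
  also have "\<dots> = (\<integral>\<^sup>+x. ennreal (std_normal_density x) * (\<integral>\<^sup>+y. ennreal (std_normal_density y) * ennreal (h (x, \<rho> * x + s * y)) \<partial>lborel) \<partial>lborel)"
    by (simp add: nn_integral_density)
  also have "\<dots> = (\<integral>\<^sup>+x. \<integral>\<^sup>+y. ennreal (pair_density \<rho> (x, y) * h (x, y)) \<partial>lborel \<partial>lborel)"
  proof (rule nn_integral_cong)
    fix x
    have nd: "normal_density (\<rho> * x) s (\<rho> * x + s * y) = std_normal_density y / s" for y
      using s by (simp add: normal_density_def real_sqrt_mult power_mult_distrib)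
    have "(\<integral>\<^sup>+y. ennreal (pair_density \<rho> (x, y) * h (x, y)) \<partial>lborel)
       = ennreal s * (\<integral>\<^sup>+y. ennreal (pair_density \<rho> (x, \<rho> * x + s * y) * h (x, \<rho> * x + s * y)) \<partial>lborel)"
      using s by (subst nn_integral_real_affine[where c = s and t = "\<rho> * x"]) auto
    also have "\<dots> = (\<integral>\<^sup>+y. ennreal s * ennreal (pair_density \<rho> (x, \<rho> * x + s * y) * h (x, \<rho> * x + s * y)) \<partial>lborel)"
      by (rule nn_integral_cmult[symmetric]) simp
    also have "\<dots> = (\<integral>\<^sup>+y. ennreal (std_normal_density x) * (ennreal (std_normal_density y) * ennreal (h (x, \<rho> * x + s * y))) \<partial>lborel)"
      using s by (intro nn_integral_cong)
        (simp add: pair_density_def s_def[symmetric] nd h0 ennreal_mult'[symmetric])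
    also have "\<dots> = ennreal (std_normal_density x) * (\<integral>\<^sup>+y. ennreal (std_normal_density y) * ennreal (h (x, \<rho> * x + s * y)) \<partial>lborel)"
      by (rule nn_integral_cmult) simp
    finally show "ennreal (std_normal_density x) * (\<integral>\<^sup>+y. ennreal (std_normal_density y) * ennreal (h (x, \<rho> * x + s * y)) \<partial>lborel)
      = (\<integral>\<^sup>+y. ennreal (pair_density \<rho> (x, y) * h (x, y)) \<partial>lborel)" by simp
  qed
  also have "\<dots> = (\<integral>\<^sup>+z. ennreal (pair_density \<rho> z * h z) \<partial>(lborel \<Otimes>\<^sub>M lborel))"
    by (subst lborel.nn_integral_fst[symmetric]) simp_all
  finally have eq: "(\<integral>\<^sup>+z. ennreal (h (fst z, \<rho> * fst z + s * snd z)) \<partial>(std_normal \<Otimes>\<^sub>M std_normal))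
     = (\<integral>\<^sup>+z. ennreal (pair_density \<rho> z * h z) \<partial>(lborel \<Otimes>\<^sub>M lborel))" .
  have "0 \<le> pair_density \<rho> z" for z by (simp add: pair_density_def)
  then show ?thesis
    unfolding s_def[symmetric] using h0
    by (simp add: integral_eq_nn_integral eq)
qed

text \<open>
For \<open>\<bar>\<rho>\<bar> > 1/2\<close> the bound is trivial, since both expectations lie in the unit interval.  Hence it
holds for all \<open>\<rho>\<close> although the chi-square distance is infinite at \<open>\<bar>\<rho>\<bar> = 1\<close>.
\<close>
lemma correlated_pair_near_independent:
  fixes h :: "real \<times> real \<Rightarrow> real"
  assumes [measurable]: "h \<in> borel_measurable (borel \<Otimes>\<^sub>M borel)" and h: "\<And>z. 0 \<le> h z" "\<And>z. h z \<le> 1"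
  shows "\<bar>(\<integral>z. h (fst z, \<rho> * fst z + sqrt (1 - \<rho>\<^sup>2) * snd z) \<partial>(std_normal \<Otimes>\<^sub>M std_normal))
     - (\<integral>z. h z \<partial>(std_normal \<Otimes>\<^sub>M std_normal))\<bar> \<le> 2 * \<bar>\<rho>\<bar>"
proof (cases "\<bar>\<rho>\<bar> \<le> 1 / 2")
  case True
  have "\<bar>\<rho>\<bar>\<^sup>2 \<le> (1 / 2)\<^sup>2" using True by (intro power_mono) auto
  then have \<rho>2: "\<rho>\<^sup>2 < 1" by (simp add: power2_eq_square)
  let ?L = "lborel \<Otimes>\<^sub>M lborel :: (real \<times> real) measure"
  let ?p = "pair_density \<rho>" and ?q = "pair_density 0"
  have p: "integrable ?L ?p" and q: "integrable ?L ?q"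
    using \<rho>2 pair_density_mass[of \<rho>] pair_density_mass[of 0] by (auto intro: integrable.intros)
  have bd: "integrable ?L (\<lambda>z. f z * h z)" if f: "integrable ?L f" for f
  proof (rule Bochner_Integration.integrable_bound[OF f])
    have [measurable]: "f \<in> borel_measurable ?L" using f by (rule borel_measurable_integrable)
    show "(\<lambda>z. f z * h z) \<in> borel_measurable ?L" by measurable
    show "AE z in ?L. norm (f z * h z) \<le> norm (f z)"
      using h by (intro AE_I2) (simp add: abs_mult mult_left_le)
  qed
  have ph: "integrable ?L (\<lambda>z. ?p z * h z)" and qh: "integrable ?L (\<lambda>z. ?q z * h z)"
    using p q by (auto intro: bd)
  have "(\<integral>z. h (fst z, \<rho> * fst z + sqrt (1 - \<rho>\<^sup>2) * snd z) \<partial>(std_normal \<Otimes>\<^sub>M std_normal))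
     - (\<integral>z. h z \<partial>(std_normal \<Otimes>\<^sub>M std_normal)) = (\<integral>z. ?p z * h z \<partial>?L) - (\<integral>z. ?q z * h z \<partial>?L)"
    using integral_correlated_pair[OF \<rho>2, of h] integral_correlated_pair[of 0 h] h by simp
  also have "\<dots> = (\<integral>z. (?p z - ?q z) * h z \<partial>?L)"
    using ph qh by (simp add: left_diff_distrib)
  finally have "\<bar>(\<integral>z. h (fst z, \<rho> * fst z + sqrt (1 - \<rho>\<^sup>2) * snd z) \<partial>(std_normal \<Otimes>\<^sub>M std_normal))
     - (\<integral>z. h z \<partial>(std_normal \<Otimes>\<^sub>M std_normal))\<bar> = \<bar>\<integral>z. (?p z - ?q z) * h z \<partial>?L\<bar>" by simp
  also have "\<dots> \<le> (\<integral>z. \<bar>(?p z - ?q z) * h z\<bar> \<partial>?L)" by (rule integral_abs_bound)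
  also have "\<dots> \<le> (\<integral>z. \<bar>?p z - ?q z\<bar> \<partial>?L)"
  proof (rule integral_mono)
    show "integrable ?L (\<lambda>z. \<bar>(?p z - ?q z) * h z\<bar>)"
      using ph qh by (intro integrable_abs) (simp add: left_diff_distrib)
    show "integrable ?L (\<lambda>z. \<bar>?p z - ?q z\<bar>)"
      using p q by (intro integrable_abs) simp
    show "\<bar>(?p z - ?q z) * h z\<bar> \<le> \<bar>?p z - ?q z\<bar>" for z
      using h[of z] by (simp add: abs_mult mult_left_le)
  qed
  also have "\<dots> \<le> 2 * \<bar>\<rho>\<bar>" by (rule pair_density_L1[OF True])
  finally show ?thesis .
next
  case False
  have P: "prob_space (std_normal \<Otimes>\<^sub>M std_normal)"
    by (intro prob_space_pair prob_space_std_normal)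
  let ?c = "\<lambda>z. (fst z, \<rho> * fst z + sqrt (1 - \<rho>\<^sup>2) * snd z)"
  have "0 \<le> (\<integral>z. h z \<partial>(std_normal \<Otimes>\<^sub>M std_normal))" "(\<integral>z. h z \<partial>(std_normal \<Otimes>\<^sub>M std_normal)) \<le> 1"
    "0 \<le> (\<integral>z. h (?c z) \<partial>(std_normal \<Otimes>\<^sub>M std_normal))" "(\<integral>z. h (?c z) \<partial>(std_normal \<Otimes>\<^sub>M std_normal)) \<le> 1"
    by (rule integral_unit_interval[OF P]; rule h)+
  then show ?thesis using False unfolding abs_le_iff by linarith
qed

lemma measurable_snoc_PiM:
  "(\<lambda>(x, a). x(n := a)) \<in> (\<Pi>\<^sub>M i\<in>{..<n}. borel) \<Otimes>\<^sub>M borel \<rightarrow>\<^sub>M (\<Pi>\<^sub>M i\<in>{..<Suc n}. borel)"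
  unfolding lessThan_Suc by (rule measurable_add_dim)

lemma restrict_snoc:
  "(\<lambda>i\<in>{..<Suc n}. p ((w(n := v)) i)) = (\<lambda>i\<in>{..<n}. p (w i))(n := p v)"
  by (auto simp: fun_eq_iff restrict_def)

text \<open>
Integrating out the last row first, by the hypothesis on a single row the two functions can be
decoupled there at the cost \<open>d\<close>; what is left is again a product of two functions with values in the
unit interval, now of \<open>n\<close> rows.  Products of functions of the two columns are enough for a
covariance, and they make the induction close.
\<close>
lemma tensorized_decorrelation:
  fixes \<nu> :: "('a::topological_space \<times> 'b::topological_space) measure" and d :: real
  assumes \<nu>: "prob_space \<nu>" "sets \<nu> = sets (borel \<Otimes>\<^sub>M borel)"
    and N1: "prob_space N1" "sets N1 = sets borel" and N2: "prob_space N2" "sets N2 = sets borel"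
    and d: "\<And>f g. f \<in> borel_measurable borel \<Longrightarrow> g \<in> borel_measurable borel \<Longrightarrow>
       (\<And>x. 0 \<le> f x) \<Longrightarrow> (\<And>x. f x \<le> 1) \<Longrightarrow> (\<And>x. 0 \<le> g x) \<Longrightarrow> (\<And>x. g x \<le> 1) \<Longrightarrow>
       \<bar>(\<integral>w. f (fst w) * g (snd w) \<partial>\<nu>) - (\<integral>x. f x \<partial>N1) * (\<integral>x. g x \<partial>N2)\<bar> \<le> d"
    and "f \<in> borel_measurable (\<Pi>\<^sub>M i\<in>{..<n}. borel)" "g \<in> borel_measurable (\<Pi>\<^sub>M i\<in>{..<n}. borel)"
    and "\<And>x. 0 \<le> f x" "\<And>x. f x \<le> 1" "\<And>x. 0 \<le> g x" "\<And>x. g x \<le> 1"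
  shows "\<bar>(\<integral>w. f (\<lambda>i\<in>{..<n}. fst (w i)) * g (\<lambda>i\<in>{..<n}. snd (w i)) \<partial>(\<Pi>\<^sub>M i\<in>{..<n}. \<nu>))
      - (\<integral>x. f x \<partial>(\<Pi>\<^sub>M i\<in>{..<n}. N1)) * (\<integral>x. g x \<partial>(\<Pi>\<^sub>M i\<in>{..<n}. N2))\<bar> \<le> real n * d"
  using assms(8-)
proof (induction n arbitrary: f g)
  case 0
  show ?case by (simp add: PiM_empty lebesgue_integral_count_space_finite restrict_def)
next
  case (Suc n)
  note [measurable] = Suc.prems(1,2) measurable_snoc_PiM
  note f = Suc.prems(3,4) and g = Suc.prems(5,6)
  note [measurable_cong] = \<nu>(2) N1(2) N2(2)
  interpret \<nu>: prob_space \<nu> by fact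
  interpret N1: prob_space N1 by fact
  interpret N2: prob_space N2 by fact
  interpret P: product_prob_space "\<lambda>_. \<nu>" UNIV by unfold_locales
  interpret P1: product_prob_space "\<lambda>_. N1" UNIV by unfold_locales
  interpret P2: product_prob_space "\<lambda>_. N2" UNIV by unfold_locales
  let ?P = "\<lambda>n::nat. \<Pi>\<^sub>M i\<in>{..<n}. \<nu>" and ?P1 = "\<lambda>n::nat. \<Pi>\<^sub>M i\<in>{..<n}. N1" and ?P2 = "\<lambda>n::nat. \<Pi>\<^sub>M i\<in>{..<n}. N2"
  have sets_PiM1[measurable_cong]: "sets (?P1 n) = sets (\<Pi>\<^sub>M i\<in>{..<n}. borel)"
   and sets_PiM2[measurable_cong]: "sets (?P2 n) = sets (\<Pi>\<^sub>M i\<in>{..<n}. borel)" 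
   and sets_PiM[measurable_cong]: "sets (?P n) = sets (\<Pi>\<^sub>M i\<in>{..<n}. borel \<Otimes>\<^sub>M borel)" for n
    by (auto intro!: sets_PiM_cong simp: \<nu> N1 N2)
  \<comment> \<open>the two functions with the last row averaged out under the marginal laws\<close>
  define F where "F x = (\<integral>a. f (x(n := a)) \<partial>N1)" for x
  define G where "G x = (\<integral>a. g (x(n := a)) \<partial>N2)" for x
  have f_snoc[measurable]: "(\<lambda>z. f ((fst z)(n := snd z))) \<in> borel_measurable ((\<Pi>\<^sub>M i\<in>{..<n}. borel) \<Otimes>\<^sub>M borel)"
    using measurable_compose[OF measurable_snoc_PiM Suc.prems(1)] by (simp add: case_prod_beta')
  have g_snoc[measurable]: "(\<lambda>z. g ((fst z)(n := snd z))) \<in> borel_measurable ((\<Pi>\<^sub>M i\<in>{..<n}. borel) \<Otimes>\<^sub>M borel)"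
    using measurable_compose[OF measurable_snoc_PiM Suc.prems(2)] by (simp add: case_prod_beta')
  have f1: "(\<lambda>a. f (x(n := a))) \<in> borel_measurable borel" if "x \<in> space (\<Pi>\<^sub>M i\<in>{..<n}. borel)" for x
    using measurable_compose[OF measurable_Pair1'[OF that] f_snoc] by simp
  have g1: "(\<lambda>a. g (x(n := a))) \<in> borel_measurable borel" if "x \<in> space (\<Pi>\<^sub>M i\<in>{..<n}. borel)" for x
    using measurable_compose[OF measurable_Pair1'[OF that] g_snoc] by simp
  have FG[measurable]: "F \<in> borel_measurable (\<Pi>\<^sub>M i\<in>{..<n}. borel)" "G \<in> borel_measurable (\<Pi>\<^sub>M i\<in>{..<n}. borel)"
    unfolding F_def G_def by measurable
  have F: "0 \<le> F x" "F x \<le> 1" for x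
    unfolding F_def by (rule integral_unit_interval, rule N1, rule f, rule f)+
  have G: "0 \<le> G x" "G x \<le> 1" for x
    unfolding G_def by (rule integral_unit_interval, rule N2, rule g, rule g)+
  have PP: "prob_space (?P n)" "prob_space (?P (Suc n))" "prob_space (?P1 (Suc n))" "prob_space (?P2 (Suc n))"
    by (intro prob_space_PiM \<nu> N1 N2)+
  interpret Pn: prob_space "?P n" by fact
  let ?h = "\<lambda>w. f (\<lambda>i\<in>{..<Suc n}. fst (w i)) * g (\<lambda>i\<in>{..<Suc n}. snd (w i))"
  have h_bd: "0 \<le> ?h w" "?h w \<le> 1" for w using f g by (auto intro: mult_le_one)
  have int_h: "integrable (?P (Suc n)) ?h"
    by (rule finite_measure.integrable_const_bound[where B = 1])
      (use h_bd PP in \<open>auto intro!: AE_I2 simp: prob_space.finite_measure\<close>)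
  \<comment> \<open>the last row averaged out under the joint law\<close>
  define A where "A w = (\<integral>v. f ((\<lambda>i\<in>{..<n}. fst (w i))(n := fst v)) * g ((\<lambda>i\<in>{..<n}. snd (w i))(n := snd v)) \<partial>\<nu>)" for w
  have joint: "(\<integral>w. ?h w \<partial>?P (Suc n)) = (\<integral>w. A w \<partial>?P n)"
    unfolding A_def restrict_snoc[symmetric]
    by (rule P.product_integral_insert[of "{..<n}" n, folded lessThan_Suc, OF _ _ int_h]) simp_all
  have near: "\<bar>A w - F (\<lambda>i\<in>{..<n}. fst (w i)) * G (\<lambda>i\<in>{..<n}. snd (w i))\<bar> \<le> d" for w
    unfolding A_def F_def G_def by (rule d[OF f1 g1]) (simp_all add: space_PiM f g)
  have int1: "integrable (?P n) A"
  proof (rule Pn.integrable_const_bound[where B = 1])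
    show "A \<in> borel_measurable (?P n)" unfolding A_def by measurable
    have "0 \<le> A w \<and> A w \<le> 1" for w unfolding A_def
      using f g by (intro conjI integral_unit_interval \<nu>(1)) (auto intro: mult_le_one)
    then show "AE w in ?P n. norm (A w) \<le> 1" by (intro AE_I2) simp
  qed
  have int2: "integrable (?P n) (\<lambda>w. F (\<lambda>i\<in>{..<n}. fst (w i)) * G (\<lambda>i\<in>{..<n}. snd (w i)))"
    by (rule Pn.integrable_const_bound[where B = 1])
      (use F G in \<open>auto intro!: AE_I2 mult_le_one simp: abs_mult\<close>)
  have "\<bar>(\<integral>w. A w \<partial>?P n) - (\<integral>w. F (\<lambda>i\<in>{..<n}. fst (w i)) * G (\<lambda>i\<in>{..<n}. snd (w i)) \<partial>?P n)\<bar>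
      = \<bar>\<integral>w. A w - F (\<lambda>i\<in>{..<n}. fst (w i)) * G (\<lambda>i\<in>{..<n}. snd (w i)) \<partial>?P n\<bar>"
    using int1 int2 by simp
  also have "\<dots> \<le> (\<integral>w. \<bar>A w - F (\<lambda>i\<in>{..<n}. fst (w i)) * G (\<lambda>i\<in>{..<n}. snd (w i))\<bar> \<partial>?P n)"
    by (rule integral_abs_bound)
  also have "\<dots> \<le> d"
    using int1 int2 near by (intro Pn.integral_le_const integrable_abs) auto
  finally have 1: "\<bar>(\<integral>w. A w \<partial>?P n) - (\<integral>w. F (\<lambda>i\<in>{..<n}. fst (w i)) * G (\<lambda>i\<in>{..<n}. snd (w i)) \<partial>?P n)\<bar> \<le> d" .
  have marg1: "(\<integral>x. f x \<partial>?P1 (Suc n)) = (\<integral>x. F x \<partial>?P1 n)"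
  proof -
    have "integrable (?P1 (Suc n)) f"
      by (rule finite_measure.integrable_const_bound[where B = 1])
        (use f PP in \<open>auto intro!: AE_I2 simp: prob_space.finite_measure\<close>)
    then show ?thesis unfolding lessThan_Suc F_def by (subst P1.product_integral_insert) auto
  qed
  have marg2: "(\<integral>x. g x \<partial>?P2 (Suc n)) = (\<integral>x. G x \<partial>?P2 n)"
  proof -
    have "integrable (?P2 (Suc n)) g"
      by (rule finite_measure.integrable_const_bound[where B = 1])
        (use g PP in \<open>auto intro!: AE_I2 simp: prob_space.finite_measure\<close>)
    then show ?thesis unfolding lessThan_Suc G_def by (subst P2.product_integral_insert) auto
  qed
  have 2: "\<bar>(\<integral>w. F (\<lambda>i\<in>{..<n}. fst (w i)) * G (\<lambda>i\<in>{..<n}. snd (w i)) \<partial>?P n)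
      - (\<integral>x. F x \<partial>?P1 n) * (\<integral>x. G x \<partial>?P2 n)\<bar> \<le> real n * d"
    by (rule Suc.IH) (use FG F G in auto)
  have "real (Suc n) * d = d + real n * d" by (simp add: algebra_simps)
  then show ?case unfolding joint marg1 marg2 using 1 2 by linarith
qed

section \<open>A strong law for bounded, weakly correlated variables\<close>

text \<open>
The expected sum of the squares is finite, so the sum is almost surely finite and its terms tend
to 0.
\<close>
lemma AE_tendsto_0_of_summable_square_means:
  fixes Z :: "nat \<Rightarrow> 'a \<Rightarrow> real"
  assumes "prob_space M" and [measurable]: "\<And>k. Z k \<in> borel_measurable M"
    and int: "\<And>k. integrable M (\<lambda>\<omega>. (Z k \<omega>)\<^sup>2)"
    and summ: "summable (\<lambda>k. \<integral>\<omega>. (Z k \<omega>)\<^sup>2 \<partial>M)"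
  shows "AE \<omega> in M. (\<lambda>k. Z k \<omega>) \<longlonglongrightarrow> 0"
proof -
  interpret prob_space M by fact
  have "(\<integral>\<^sup>+\<omega>. (\<Sum>k. ennreal ((Z k \<omega>)\<^sup>2)) \<partial>M) = (\<Sum>k. \<integral>\<^sup>+\<omega>. ennreal ((Z k \<omega>)\<^sup>2) \<partial>M)"
    by (rule nn_integral_suminf) simp
  also have "\<dots> = (\<Sum>k. ennreal (\<integral>\<omega>. (Z k \<omega>)\<^sup>2 \<partial>M))"
    using int by (simp add: nn_integral_eq_integral)
  also have "\<dots> = ennreal (\<Sum>k. \<integral>\<omega>. (Z k \<omega>)\<^sup>2 \<partial>M)"
    using summ by (intro suminf_ennreal2) auto
  finally have "(\<integral>\<^sup>+\<omega>. (\<Sum>k. ennreal ((Z k \<omega>)\<^sup>2)) \<partial>M) \<noteq> \<infinity>" by simp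
  then have "AE \<omega> in M. (\<Sum>k. ennreal ((Z k \<omega>)\<^sup>2)) \<noteq> \<infinity>"
    by (intro nn_integral_noteq_infinite) simp_all
  then show ?thesis
  proof eventually_elim
    case (elim \<omega>)
    then have "summable (\<lambda>k. (Z k \<omega>)\<^sup>2)" by (intro summable_suminf_not_top) (auto simp: top_ennreal_def)
    then have "(\<lambda>k. (Z k \<omega>)\<^sup>2) \<longlonglongrightarrow> 0" by (rule summable_LIMSEQ_zero)
    then have "(\<lambda>k. sqrt ((Z k \<omega>)\<^sup>2)) \<longlonglongrightarrow> sqrt 0" by (intro tendsto_intros)
    then show ?case by (simp add: tendsto_rabs_zero_iff)
  qed
qed

text \<open>
Between consecutive \<open>a\<close>-th powers \<open>m \<le> p < m'\<close> a sum of terms bounded by 1 changes by at most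
\<open>m' - m\<close>, and \<open>(m' - m) / m\<close> tends to 0.
\<close>
lemma averages_tendsto_of_polynomial_subsequence:
  fixes y :: "nat \<Rightarrow> real" and a :: nat
  assumes y: "\<And>j. \<bar>y j\<bar> \<le> 1" and a: "a > 0"
    and lim: "(\<lambda>k. (\<Sum>j<Suc k ^ a. y j) / real (Suc k ^ a)) \<longlonglongrightarrow> 0"
  shows "(\<lambda>p. (\<Sum>j<p. y j) / real p) \<longlonglongrightarrow> 0"
proof -
  define S where "S p = (\<Sum>j<p. y j)" for p
  define P where "P k = Suc k ^ a" for k
  define K where "K p = Max {k. P k \<le> p}" for p
  have P_gt: "k < P k" for k
  proof -
    have "Suc k ^ 1 \<le> Suc k ^ a" using a by (intro power_increasing) auto
    then show ?thesis by (simp add: P_def)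
  qed
  have fin: "finite {k. P k \<le> p}" for p
    by (rule finite_subset[of _ "{..p}"]) (use P_gt in \<open>auto intro: less_imp_le less_le_trans\<close>)
  have K: "P (K p) \<le> p" "p < P (Suc (K p))" if "p \<ge> 1" for p
  proof -
    have "0 \<in> {k. P k \<le> p}" using that by (simp add: P_def)
    then have "K p \<in> {k. P k \<le> p}" unfolding K_def using fin by (intro Max_in) auto
    then show "P (K p) \<le> p" by simp
    show "p < P (Suc (K p))"
    proof (rule ccontr)
      assume "\<not> p < P (Suc (K p))"
      then have "Suc (K p) \<le> K p" unfolding K_def[of p] using fin by (intro Max_ge) auto
      then show False by simp
    qed
  qed
  have K_top: "filterlim K at_top sequentially"
    unfolding filterlim_at_top
  proof
    fix Z
    have "Z \<le> K p" if "p \<ge> P Z" for p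
      unfolding K_def using that fin by (intro Max_ge) auto
    then show "eventually (\<lambda>p. Z \<le> K p) sequentially" by (auto simp: eventually_sequentially)
  qed
  have "(\<lambda>k. real (Suc (Suc k)) / real (Suc k)) \<longlonglongrightarrow> 1"
    by (rule LIMSEQ_Suc[OF LIMSEQ_Suc_n_over_n])
  then have "(\<lambda>k. (real (Suc (Suc k)) / real (Suc k)) ^ a) \<longlonglongrightarrow> 1 ^ a" by (rule tendsto_power)
  then have "(\<lambda>k. real (P (Suc k)) / real (P k)) \<longlonglongrightarrow> 1"
    by (simp add: P_def power_divide)
  then have "(\<lambda>k. \<bar>S (P k) / real (P k)\<bar> + (real (P (Suc k)) / real (P k) - 1)) \<longlonglongrightarrow> \<bar>0\<bar> + (1 - 1)"
    using lim unfolding S_def P_def by (intro tendsto_intros)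
  then have "(\<lambda>k. \<bar>S (P k) / real (P k)\<bar> + (real (P (Suc k)) / real (P k) - 1)) \<longlonglongrightarrow> 0" by simp
  from filterlim_compose[OF this K_top]
  have lim0: "(\<lambda>p. \<bar>S (P (K p)) / real (P (K p))\<bar> + (real (P (Suc (K p))) / real (P (K p)) - 1)) \<longlonglongrightarrow> 0" .
  have "\<bar>S p / real p\<bar> \<le> \<bar>S (P (K p)) / real (P (K p))\<bar> + (real (P (Suc (K p))) / real (P (K p)) - 1)"
    if p: "p \<ge> 1" for p
  proof -
    define m where "m = P (K p)"
    have m: "m > 0" "m \<le> p" "p < P (Suc (K p))" using K[OF p] by (auto simp: m_def P_def)
    have "S p = S m + (\<Sum>j\<in>{m..<p}. y j)"
      unfolding S_def using m by (simp add: sum.atLeastLessThan_concat[of 0 m p, symmetric] lessThan_atLeast0)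
    moreover have "\<bar>\<Sum>j\<in>{m..<p}. y j\<bar> \<le> (\<Sum>j\<in>{m..<p}. 1)"
      using y by (intro order_trans[OF sum_abs] sum_mono)
    ultimately have "\<bar>S p\<bar> \<le> \<bar>S m\<bar> + (real p - real m)" using m by simp
    also have "\<dots> \<le> \<bar>S m\<bar> + (real (P (Suc (K p))) - real m)" using m by simp
    finally have "\<bar>S p\<bar> / real p \<le> (\<bar>S m\<bar> + (real (P (Suc (K p))) - real m)) / real p"
      by (rule divide_right_mono) simp
    also have "\<dots> \<le> (\<bar>S m\<bar> + (real (P (Suc (K p))) - real m)) / real m"
      using m by (intro divide_left_mono) auto
    also have "\<dots> = \<bar>S m / real m\<bar> + (real (P (Suc (K p))) / real m - 1)"
      using m by (simp add: field_simps)
    finally show ?thesis by (simp add: m_def)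
  qed
  then have "eventually (\<lambda>p. \<bar>S p / real p\<bar> \<le> \<bar>S (P (K p)) / real (P (K p))\<bar> + (real (P (Suc (K p))) / real (P (K p)) - 1)) sequentially"
    by (auto simp: eventually_sequentially)
  then have "(\<lambda>p. S p / real p) \<longlonglongrightarrow> 0"
    by (intro Lim_null_comparison[OF _ lim0]) simp
  then show ?thesis by (simp add: S_def)
qed

text \<open>
The variances of the averages are \<open>O(p powr (- \<delta>))\<close>; they are summable along \<open>p = k ^ a\<close> as
soon as \<open>a * \<delta> > 2\<close>.  Boundedness handles the gaps between the powers.
\<close>
lemma weakly_correlated_strong_law:
  fixes Y :: "nat \<Rightarrow> 'a \<Rightarrow> real" and c :: "nat \<Rightarrow> nat \<Rightarrow> real"
  assumes "prob_space M" and [measurable]: "\<And>j. Y j \<in> borel_measurable M"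
    and bound: "\<And>j \<omega>. \<bar>Y j \<omega>\<bar> \<le> 1"
    and cov: "\<And>j k. \<bar>\<integral>\<omega>. Y j \<omega> * Y k \<omega> \<partial>M\<bar> \<le> C * c j k" and "C \<ge> 0"
    and decay: "\<delta> > 0" "(\<lambda>p. (\<Sum>j<p. \<Sum>k<p. c j k) / (real p)\<^sup>2) \<in> O(\<lambda>p. real p powr (- \<delta>))"
  shows "AE \<omega> in M. (\<lambda>p. (\<Sum>j<p. Y j \<omega>) / real p) \<longlonglongrightarrow> 0"
proof -
  interpret prob_space M by fact
  define Z where "Z p \<omega> = (\<Sum>j<p. Y j \<omega>) / real p" for p \<omega>
  have [measurable]: "Z p \<in> borel_measurable M" for p unfolding Z_def by measurable
  have intYY: "integrable M (\<lambda>\<omega>. Y j \<omega> * Y k \<omega>)" for j k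
    using bound by (intro integrable_const_bound[where B = 1] AE_I2) (simp_all add: abs_mult mult_le_one)
  have Z2: "(Z p \<omega>)\<^sup>2 = (\<Sum>j<p. \<Sum>k<p. Y j \<omega> * Y k \<omega>) / (real p)\<^sup>2" for p \<omega>
    by (simp add: Z_def power_divide power2_eq_square sum_product)
  have intZ: "integrable M (\<lambda>\<omega>. (Z p \<omega>)\<^sup>2)" for p
    unfolding Z2 using intYY by auto
  have EZ: "(\<integral>\<omega>. (Z p \<omega>)\<^sup>2 \<partial>M) \<le> C * ((\<Sum>j<p. \<Sum>k<p. c j k) / (real p)\<^sup>2)" for p
  proof -
    have "(\<integral>\<omega>. (Z p \<omega>)\<^sup>2 \<partial>M) = (\<Sum>j<p. \<Sum>k<p. \<integral>\<omega>. Y j \<omega> * Y k \<omega> \<partial>M) / (real p)\<^sup>2"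
      unfolding Z2 using intYY by simp
    also have "\<dots> \<le> (\<Sum>j<p. \<Sum>k<p. C * c j k) / (real p)\<^sup>2"
      using cov by (intro divide_right_mono sum_mono) (auto intro: order_trans[OF abs_ge_self])
    also have "\<dots> = C * ((\<Sum>j<p. \<Sum>k<p. c j k) / (real p)\<^sup>2)"
      by (simp add: sum_distrib_left)
    finally show ?thesis .
  qed
  obtain B where "B > 0" and B: "eventually (\<lambda>p. norm ((\<Sum>j<p. \<Sum>k<p. c j k) / (real p)\<^sup>2) \<le> B * norm (real p powr (- \<delta>))) at_top"
    using decay(2) by (elim landau_o.bigE)
  from B obtain p0 where p0': "\<And>p. p \<ge> p0 \<Longrightarrow>
      norm ((\<Sum>j<p. \<Sum>k<p. c j k) / (real p)\<^sup>2) \<le> B * norm (real p powr (- \<delta>))"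
    unfolding eventually_at_top_linorder by blast
  have p0: "(\<Sum>j<p. \<Sum>k<p. c j k) / (real p)\<^sup>2 \<le> B * real p powr (- \<delta>)" if "p \<ge> p0" for p
    using order_trans[OF abs_ge_self p0'[OF that, unfolded real_norm_def]] by simp
  obtain a :: nat where a: "2 / \<delta> < real a" using reals_Archimedean2 by blast
  then have a0: "a > 0" using decay(1) by (cases a) (auto simp: divide_less_0_iff)
  have summ: "summable (\<lambda>k. \<integral>\<omega>. (Z (Suc k ^ a) \<omega>)\<^sup>2 \<partial>M)"
  proof (rule summable_comparison_test_ev)
    show "summable (\<lambda>k. C * B * inverse (real (Suc k) ^ 2))"
      using inverse_power_summable[of 2, where 'a = real] by (intro summable_mult) (subst summable_Suc_iff, simp)
    show "eventually (\<lambda>k. norm (\<integral>\<omega>. (Z (Suc k ^ a) \<omega>)\<^sup>2 \<partial>M) \<le> C * B * inverse (real (Suc k) ^ 2)) sequentially"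
      using eventually_ge_at_top[of p0]
    proof eventually_elim
      case (elim k)
      have "p0 \<le> Suc k ^ 1" using elim by simp
      also have "Suc k ^ 1 \<le> Suc k ^ a" using a0 by (intro power_increasing) auto
      finally have ge: "p0 \<le> Suc k ^ a" .
      have "real (Suc k ^ a) powr (- \<delta>) = real (Suc k) powr (- (real a * \<delta>))"
      proof -
        have "real (Suc k ^ a) = real (Suc k) powr real a" by (simp add: powr_realpow del: of_nat_Suc)
        then show ?thesis by (simp only: powr_powr mult_minus_right)
      qed
      also have "\<dots> \<le> real (Suc k) powr (- 2)"
        using a decay(1) by (intro powr_mono) (auto simp: field_simps)
      also have "\<dots> = inverse (real (Suc k) ^ 2)" by (simp add: powr_minus del: of_nat_Suc)
      finally have pw: "real (Suc k ^ a) powr (- \<delta>) \<le> inverse (real (Suc k) ^ 2)" .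
      have "(\<integral>\<omega>. (Z (Suc k ^ a) \<omega>)\<^sup>2 \<partial>M) \<le> C * (B * real (Suc k ^ a) powr (- \<delta>))"
        using \<open>C \<ge> 0\<close> p0[OF ge] by (intro order_trans[OF EZ] mult_left_mono)
      also have "\<dots> \<le> C * (B * inverse (real (Suc k) ^ 2))"
        using \<open>C \<ge> 0\<close> \<open>B > 0\<close> pw by (intro mult_left_mono) auto
      finally show ?case by (simp add: mult.assoc)
    qed
  qed
  have "AE \<omega> in M. (\<lambda>k. Z (Suc k ^ a) \<omega>) \<longlonglongrightarrow> 0"
    by (rule AE_tendsto_0_of_summable_square_means) (fact | simp add: intZ)+
  then show ?thesis
  proof eventually_elim
    case (elim \<omega>)
    then show ?case using bound a0
      by (intro averages_tendsto_of_polynomial_subsequence[where a = a]) (auto simp: Z_def)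
  qed
qed

section \<open>The false discovery proportion\<close>

text \<open>
A function \<open>Y\<close> of single rows is used with two instances, the selection of one column and of a pair
of columns.
\<close>
lemma distr_indep_rows_eq_PiM:
  fixes X :: "nat \<Rightarrow> nat \<Rightarrow> 'a \<Rightarrow> real"
  assumes "prob_space M" and n: "n > 0"
    and rows: "prob_space.indep_vars M (\<lambda>_. \<Pi>\<^sub>M j\<in>UNIV. borel) (\<lambda>i \<omega> j. X i j \<omega>) {..<n}"
    and Y: "Y \<in> (\<Pi>\<^sub>M j\<in>UNIV. borel) \<rightarrow>\<^sub>M N"
    and law: "\<And>i. i < n \<Longrightarrow> distr M N (\<lambda>\<omega>. Y (\<lambda>j. X i j \<omega>)) = D"
  shows "distr M (\<Pi>\<^sub>M i\<in>{..<n}. N) (\<lambda>\<omega>. \<lambda>i\<in>{..<n}. Y (\<lambda>j. X i j \<omega>)) = (\<Pi>\<^sub>M i\<in>{..<n}. D)"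
proof -
  interpret prob_space M by fact
  have row: "(\<lambda>\<omega> j. X i j \<omega>) \<in> M \<rightarrow>\<^sub>M (\<Pi>\<^sub>M j\<in>UNIV. borel)" if "i < n" for i
    using rows that unfolding indep_vars_def by auto
  have "indep_vars (\<lambda>_. N) (\<lambda>i \<omega>. Y (\<lambda>j. X i j \<omega>)) {..<n}"
    using indep_vars_compose2[OF rows, of "\<lambda>_. Y" "\<lambda>_. N"] Y by simp
  then have "distr M (\<Pi>\<^sub>M i\<in>{..<n}. N) (\<lambda>\<omega>. \<lambda>i\<in>{..<n}. Y (\<lambda>j. X i j \<omega>))
      = (\<Pi>\<^sub>M i\<in>{..<n}. distr M N (\<lambda>\<omega>. Y (\<lambda>j. X i j \<omega>)))"
    using n by (subst (asm) indep_vars_iff_distr_eq_PiM') (auto intro: measurable_compose[OF row Y])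
  also have "\<dots> = (\<Pi>\<^sub>M i\<in>{..<n}. D)"
    using law by (intro PiM_cong) auto
  finally show ?thesis .
qed

lemma ratio_difference_tendsto_0:
  fixes a b \<alpha> \<beta> :: "nat \<Rightarrow> real"
  assumes a: "(\<lambda>p. a p - \<alpha> p) \<longlonglongrightarrow> 0" and b: "(\<lambda>p. b p - \<beta> p) \<longlonglongrightarrow> 0"
    and \<alpha>: "\<And>p. \<bar>\<alpha> p\<bar> \<le> 1" and c: "c > 0" and \<beta>: "eventually (\<lambda>p. c \<le> \<beta> p) sequentially"
  shows "(\<lambda>p. a p / b p - \<alpha> p / \<beta> p) \<longlonglongrightarrow> 0"
proof (rule Lim_null_comparison)
  have "eventually (\<lambda>p. \<bar>b p - \<beta> p\<bar> < c / 2) sequentially"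
    using b c by (auto simp: tendsto_iff dist_real_def dest: spec[of _ "c / 2"])
  with \<beta> show "eventually (\<lambda>p. norm (a p / b p - \<alpha> p / \<beta> p) \<le> (\<bar>a p - \<alpha> p\<bar> + \<bar>b p - \<beta> p\<bar> / c) * (2 / c)) sequentially"
  proof eventually_elim
    case (elim p)
    have pos: "\<beta> p > 0" "b p \<ge> c / 2" "b p > 0" using elim c by (auto simp: abs_if split: if_splits)
    have ratio: "\<bar>\<alpha> p / \<beta> p\<bar> \<le> 1 / c"
      using \<alpha>[of p] elim c pos by (simp add: abs_divide frac_le)
    have "a p / b p - \<alpha> p / \<beta> p = ((a p - \<alpha> p) - \<alpha> p / \<beta> p * (b p - \<beta> p)) / b p"
      using pos by (simp add: field_simps)
    then have "\<bar>a p / b p - \<alpha> p / \<beta> p\<bar> = \<bar>(a p - \<alpha> p) - \<alpha> p / \<beta> p * (b p - \<beta> p)\<bar> * (1 / b p)"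
      using pos by (simp add: abs_divide)
    also have "\<dots> \<le> (\<bar>a p - \<alpha> p\<bar> + \<bar>b p - \<beta> p\<bar> / c) * (2 / c)"
    proof (rule mult_mono)
      have "\<bar>(a p - \<alpha> p) - \<alpha> p / \<beta> p * (b p - \<beta> p)\<bar> \<le> \<bar>a p - \<alpha> p\<bar> + \<bar>\<alpha> p / \<beta> p\<bar> * \<bar>b p - \<beta> p\<bar>"
        using abs_triangle_ineq4[of "a p - \<alpha> p" "\<alpha> p / \<beta> p * (b p - \<beta> p)"] by (simp add: abs_mult)
      also have "\<bar>\<alpha> p / \<beta> p\<bar> * \<bar>b p - \<beta> p\<bar> \<le> 1 / c * \<bar>b p - \<beta> p\<bar>"
        using ratio by (rule mult_right_mono) simp
      finally show "\<bar>(a p - \<alpha> p) - \<alpha> p / \<beta> p * (b p - \<beta> p)\<bar> \<le> \<bar>a p - \<alpha> p\<bar> + \<bar>b p - \<beta> p\<bar> / c" by simp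
      show "1 / b p \<le> 2 / c" using pos c by (simp add: field_simps)
    qed (use pos c in auto)
    finally show ?case by simp
  qed
  have "(\<lambda>p. (\<bar>a p - \<alpha> p\<bar> + \<bar>b p - \<beta> p\<bar> / c) * (2 / c)) \<longlonglongrightarrow> (\<bar>0\<bar> + \<bar>0\<bar> / c) * (2 / c)"
    using a b c by (intro tendsto_intros) auto
  then show "(\<lambda>p. (\<bar>a p - \<alpha> p\<bar> + \<bar>b p - \<beta> p\<bar> / c) * (2 / c)) \<longlonglongrightarrow> 0" by simp
qed

theorem theorem1:
  fixes M :: "'a measure"
    and X :: "nat \<Rightarrow> nat \<Rightarrow> 'a \<Rightarrow> real"
    and \<mu> :: "nat \<Rightarrow> real"
    and \<sigma> :: "nat \<Rightarrow> nat \<Rightarrow> real"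
    and n :: nat
    and t :: real
  assumes "prob_space M"
    and "n \<ge> 2"
    and "0 < t" and "t \<le> 1"
    and rows_indep: "prob_space.indep_vars M (\<lambda>_. \<Pi>\<^sub>M j\<in>UNIV. borel) (\<lambda>i \<omega> j. X i j \<omega>) {..<n}"
    and rows_normal: "\<And>i p. i < n \<Longrightarrow> multivariate_normal M p (X i) \<mu> \<sigma>"
    and unit_variances: "\<And>j. \<sigma> j j = 1"
    and weak_dependence:
      "\<exists>\<delta>>0. (\<lambda>p. (\<Sum>j<p. \<Sum>k<p. \<bar>\<sigma> j k\<bar>) / (real p)\<^sup>2) \<in> O(\<lambda>p. real p powr (- \<delta>))"
    and ratio: "limsup (null_alt_ratio M n t X \<mu>) < 1"
  shows "AE \<omega> in M.
    (\<lambda>p. FDP n t \<mu> p (\<lambda>i j. X i j \<omega>) -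
      real (card (nulls \<mu> p)) * t /
      (\<Sum>j<p. \<integral>\<omega>'.
          std_normal_cdf (t_quantile n (t / 2) * sample_sd n (\<lambda>i. X i j \<omega>') + sqrt (real n) * \<mu> j) +
          std_normal_cdf (t_quantile n (t / 2) * sample_sd n (\<lambda>i. X i j \<omega>') - sqrt (real n) * \<mu> j)
        \<partial>M))
    \<longlonglongrightarrow> 0"
proof -
  note [measurable] = measurable_sample_functions
  interpret prob_space M by fact
  note n = \<open>n \<ge> 2\<close> and t = \<open>0 < t\<close> \<open>t \<le> 1\<close>
  have n0: "n > 0" using n by simp
  have X[measurable]: "X i j \<in> borel_measurable M" if "i < n" for i j
    using rows_normal[OF that, of "Suc j"] unfolding multivariate_normal_def by auto
  let ?N = "\<Pi>\<^sub>M i\<in>{..<n}. std_normal"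
  let ?B = "\<Pi>\<^sub>M i\<in>{..<n}. (borel :: real measure)"
  have N: "prob_space ?N" by (rule prob_space_PiM_std_normal)
  interpret N: prob_space ?N by (rule N)
  have sets_N: "sets ?N = sets ?B" by (intro sets_PiM_cong) auto

  \<comment> \<open>centring the columns makes all laws independent of the means\<close>
  have pair: "distr M (borel \<Otimes>\<^sub>M borel) (\<lambda>\<omega>. (X i j \<omega> - \<mu> j, X i k \<omega> - \<mu> k)) = correlated_pair (\<sigma> j k)"
    if "i < n" for i j k
    using rows_normal[OF that, of "Suc (max j k)"] unit_variances
    by (intro multivariate_normal_pair_law) auto
  have single: "distr M borel (\<lambda>\<omega>. X i j \<omega> - \<mu> j) = std_normal" if [simp]: "i < n" for i j
  proof -
    have "distr M borel (\<lambda>\<omega>. X i j \<omega> - \<mu> j)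
        = distr (distr M (borel \<Otimes>\<^sub>M borel) (\<lambda>\<omega>. (X i j \<omega> - \<mu> j, X i j \<omega> - \<mu> j))) borel fst"
      by (subst distr_distr) (auto simp: comp_def)
    then show ?thesis by (simp add: pair distr_correlated_pair_fst)
  qed
  \<comment> \<open>restriction to the row indices makes the column an element of the product space\<close>
  define col where "col j \<omega> = (\<lambda>i\<in>{..<n}. X i j \<omega> - \<mu> j)" for j \<omega>
  have col_law: "distr M ?B (col j) = ?N" for j
    unfolding col_def using single
    by (intro distr_indep_rows_eq_PiM[OF \<open>prob_space M\<close> n0 rows_indep, of "\<lambda>x. x j - \<mu> j"]) auto
  have col[measurable]: "col j \<in> M \<rightarrow>\<^sub>M ?B" for j
    unfolding col_def by (intro measurable_restrict) auto
  have cols_law: "distr M (\<Pi>\<^sub>M i\<in>{..<n}. borel \<Otimes>\<^sub>M borel) (\<lambda>\<omega>. \<lambda>i\<in>{..<n}. (X i j \<omega> - \<mu> j, X i k \<omega> - \<mu> k))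
      = (\<Pi>\<^sub>M i\<in>{..<n}. correlated_pair (\<sigma> j k))" for j k
    using pair
    by (intro distr_indep_rows_eq_PiM[OF \<open>prob_space M\<close> n0 rows_indep, of "\<lambda>x. (x j - \<mu> j, x k - \<mu> k)"]) auto

  define f where "f j z = (of_bool (rejects n t (\<lambda>i. \<mu> j + z i)) :: real)" for j and z :: "nat \<Rightarrow> real"
  define T where "T j \<omega> = (of_bool (rejects n t (\<lambda>i. X i j \<omega>)) :: real)" for j \<omega>
  have f[measurable]: "f j \<in> borel_measurable ?B" for j unfolding f_def by measurable
  have T[measurable]: "T j \<in> borel_measurable M" for j unfolding T_def by measurable
  have f01: "0 \<le> f j z" "f j z \<le> 1" for j z by (auto simp: f_def)
  have T01: "0 \<le> T j \<omega>" "T j \<omega> \<le> 1" for j \<omega> by (auto simp: T_def)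
  have T_f: "T j \<omega> = f j (col j \<omega>)" for j \<omega>
    unfolding T_def f_def col_def by (intro arg_cong[where f = of_bool] rejects_cong) simp

  define \<xi> where "\<xi> j = (\<integral>z. f j z \<partial>?N)" for j
  have \<xi>01: "0 \<le> \<xi> j" "\<xi> j \<le> 1" for j
    unfolding \<xi>_def by (rule integral_unit_interval[OF N]; rule f01)+
  have T_mean: "(\<integral>\<omega>. T j \<omega> \<partial>M) = \<xi> j" for j
    unfolding T_f \<xi>_def by (subst col_law[of j, symmetric], subst integral_distr) auto
  have \<xi>_prob: "ennreal (\<xi> j) = emeasure ?N {z \<in> space ?N. rejects n t (\<lambda>i. \<mu> j + z i)}" for j
  proof -
    have "\<xi> j = (\<integral>z. indicator {z \<in> space ?N. rejects n t (\<lambda>i. \<mu> j + z i)} z \<partial>?N)"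
      unfolding \<xi>_def by (intro Bochner_Integration.integral_cong) (auto simp: f_def indicator_def)
    then show ?thesis by (simp add: N.emeasure_eq_measure)
  qed
  have \<xi>_null: "\<xi> j = t" if "\<mu> j = 0" for j
  proof -
    have "ennreal (\<xi> j) = ennreal t" using \<xi>_prob[of j] null_rejection_prob[OF n t] that by simp
    then show ?thesis using \<xi>01 t by simp
  qed
  have \<xi>_ge: "t / 2 \<le> \<xi> j" for j
    using rejection_prob_lower_bound[OF n t, of "\<mu> j"] \<xi>01 t by (simp add: \<xi>_prob[symmetric])
  have \<xi>_expect: "(\<integral>\<omega>'.
          std_normal_cdf (t_quantile n (t / 2) * sample_sd n (\<lambda>i. X i j \<omega>') + sqrt (real n) * \<mu> j) +
          std_normal_cdf (t_quantile n (t / 2) * sample_sd n (\<lambda>i. X i j \<omega>') - sqrt (real n) * \<mu> j)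
        \<partial>M) = \<xi> j" for j
  proof -
    define \<Psi> where "\<Psi> z = std_normal_cdf (t_quantile n (t / 2) * sample_sd n (\<lambda>i. \<mu> j + z i) + sqrt (real n) * \<mu> j) +
          std_normal_cdf (t_quantile n (t / 2) * sample_sd n (\<lambda>i. \<mu> j + z i) - sqrt (real n) * \<mu> j)" for z
    have [measurable]: "\<Psi> \<in> borel_measurable ?B" unfolding \<Psi>_def by measurable
    have \<Psi>0: "0 \<le> \<Psi> z" for z by (simp add: \<Psi>_def std_normal_cdf_bounds)
    have "sample_sd n (\<lambda>i. X i j \<omega>) = sample_sd n (\<lambda>i. \<mu> j + col j \<omega> i)" for \<omega>
      by (intro sample_sd_cong) (simp add: col_def)
    then have "(\<integral>\<omega>'.
          std_normal_cdf (t_quantile n (t / 2) * sample_sd n (\<lambda>i. X i j \<omega>') + sqrt (real n) * \<mu> j) +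
          std_normal_cdf (t_quantile n (t / 2) * sample_sd n (\<lambda>i. X i j \<omega>') - sqrt (real n) * \<mu> j)
        \<partial>M) = (\<integral>\<omega>. \<Psi> (col j \<omega>) \<partial>M)" by (simp add: \<Psi>_def)
    also have "\<dots> = (\<integral>z. \<Psi> z \<partial>?N)"
      by (subst col_law[of j, symmetric], subst integral_distr) auto
    also have "\<dots> = enn2real (\<integral>\<^sup>+z. ennreal (\<Psi> z) \<partial>?N)"
      using \<Psi>0 sets_N by (intro integral_eq_nn_integral) (auto cong: measurable_cong_sets)
    also have "(\<integral>\<^sup>+z. ennreal (\<Psi> z) \<partial>?N) = ennreal (\<xi> j)"
      unfolding \<xi>_prob \<Psi>_def by (rule rejection_prob_eq_expectation[OF n t, symmetric])
    finally show ?thesis using \<xi>01 by simp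
  qed

  have T_cov: "\<bar>(\<integral>\<omega>. T j \<omega> * T k \<omega> \<partial>M) - \<xi> j * \<xi> k\<bar> \<le> real n * (2 * \<bar>\<sigma> j k\<bar>)" for j k
  proof -
    let ?h = "\<lambda>w :: nat \<Rightarrow> real \<times> real. f j (\<lambda>i\<in>{..<n}. fst (w i)) * f k (\<lambda>i\<in>{..<n}. snd (w i))"
    have "(\<integral>\<omega>. T j \<omega> * T k \<omega> \<partial>M) = (\<integral>\<omega>. ?h (\<lambda>i\<in>{..<n}. (X i j \<omega> - \<mu> j, X i k \<omega> - \<mu> k)) \<partial>M)"
      unfolding T_f col_def by (simp cong: restrict_cong)
    also have "\<dots> = (\<integral>w. ?h w \<partial>(\<Pi>\<^sub>M i\<in>{..<n}. correlated_pair (\<sigma> j k)))"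
      by (subst cols_law[symmetric], subst integral_distr) auto
    finally have joint: "(\<integral>\<omega>. T j \<omega> * T k \<omega> \<partial>M) = (\<integral>w. ?h w \<partial>(\<Pi>\<^sub>M i\<in>{..<n}. correlated_pair (\<sigma> j k)))" .
    show ?thesis
      unfolding joint \<xi>_def
    proof (rule tensorized_decorrelation)
      fix F G :: "real \<Rightarrow> real"
      assume [measurable]: "F \<in> borel_measurable borel" "G \<in> borel_measurable borel"
        and FG: "\<And>x. 0 \<le> F x" "\<And>x. F x \<le> 1" "\<And>x. 0 \<le> G x" "\<And>x. G x \<le> 1"
      have prod: "(\<integral>z. F (fst z) * G (snd z) \<partial>(std_normal \<Otimes>\<^sub>M std_normal)) = (\<integral>x. F x \<partial>std_normal) * (\<integral>x. G x \<partial>std_normal)"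
      proof -
        interpret P: prob_space "std_normal \<Otimes>\<^sub>M std_normal"
          by (intro prob_space_pair prob_space_std_normal)
        have "integrable (std_normal \<Otimes>\<^sub>M std_normal) (\<lambda>z. F (fst z) * G (snd z))"
          using FG by (intro P.integrable_const_bound[where B = 1] AE_I2) (simp_all add: abs_mult mult_le_one)
        then have "(\<integral>z. F (fst z) * G (snd z) \<partial>(std_normal \<Otimes>\<^sub>M std_normal)) = (\<integral>x. \<integral>y. F x * G y \<partial>std_normal \<partial>std_normal)"
          by (subst std_normal_pair.integral_fst'[symmetric]) simp_all
        then show ?thesis by simp
      qed
      have "(\<integral>w. F (fst w) * G (snd w) \<partial>correlated_pair (\<sigma> j k))
        = (\<integral>z. F (fst z) * G (\<sigma> j k * fst z + sqrt (1 - (\<sigma> j k)\<^sup>2) * snd z) \<partial>(std_normal \<Otimes>\<^sub>M std_normal))"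
        unfolding correlated_pair_def by (subst integral_distr) auto
      then show "\<bar>(\<integral>w. F (fst w) * G (snd w) \<partial>correlated_pair (\<sigma> j k))
          - (\<integral>x. F x \<partial>std_normal) * (\<integral>x. G x \<partial>std_normal)\<bar> \<le> 2 * \<bar>\<sigma> j k\<bar>"
        using correlated_pair_near_independent[of "\<lambda>z. F (fst z) * G (snd z)" "\<sigma> j k"] FG prod
        by (simp add: mult_le_one)
    qed (use f01 in \<open>auto intro: prob_space_correlated_pair prob_space_std_normal\<close>)
  qed

  define Y where "Y j \<omega> = T j \<omega> - \<xi> j" for j \<omega>
  have [measurable]: "Y j \<in> borel_measurable M" for j unfolding Y_def by measurable
  have Y1: "\<bar>Y j \<omega>\<bar> \<le> 1" for j \<omega>
    using T01[of j \<omega>] \<xi>01[of j] by (simp add: Y_def abs_le_iff)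
  have Y_cov: "\<bar>\<integral>\<omega>. Y j \<omega> * Y k \<omega> \<partial>M\<bar> \<le> 2 * real n * \<bar>\<sigma> j k\<bar>" for j k
  proof -
    have int: "integrable M (T j)" for j
      using T01 by (intro integrable_const_bound[where B = 1] AE_I2) simp_all
    have int2: "integrable M (\<lambda>\<omega>. T j \<omega> * T k \<omega>)"
      using T01 by (intro integrable_const_bound[where B = 1] AE_I2) (simp_all add: abs_mult mult_le_one)
    have "(\<integral>\<omega>. Y j \<omega> * Y k \<omega> \<partial>M) = (\<integral>\<omega>. T j \<omega> * T k \<omega> - \<xi> k * T j \<omega> - \<xi> j * T k \<omega> + \<xi> j * \<xi> k \<partial>M)"
      by (simp add: Y_def algebra_simps)
    also have "\<dots> = (\<integral>\<omega>. T j \<omega> * T k \<omega> \<partial>M) - \<xi> j * \<xi> k"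
      using int int2 by (simp add: T_mean prob_space)
    finally show ?thesis using T_cov[of j k] by simp
  qed
  obtain \<delta> where \<delta>: "\<delta> > 0" "(\<lambda>p. (\<Sum>j<p. \<Sum>k<p. \<bar>\<sigma> j k\<bar>) / (real p)\<^sup>2) \<in> O(\<lambda>p. real p powr (- \<delta>))"
    using weak_dependence by blast
  have all: "AE \<omega> in M. (\<lambda>p. (\<Sum>j<p. Y j \<omega>) / real p) \<longlonglongrightarrow> 0"
    by (rule weakly_correlated_strong_law[OF \<open>prob_space M\<close> _ Y1 Y_cov _ \<delta>]) simp_all
  \<comment> \<open>the false rejections are the same sum with the alternatives set to 0, which preserves the covariance bound\<close>
  define Y0 where "Y0 j \<omega> = (if \<mu> j = 0 then Y j \<omega> else 0)" for j \<omega>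
  have [measurable]: "Y0 j \<in> borel_measurable M" for j unfolding Y0_def by (cases "\<mu> j = 0") simp_all
  have "AE \<omega> in M. (\<lambda>p. (\<Sum>j<p. Y0 j \<omega>) / real p) \<longlonglongrightarrow> 0"
  proof (rule weakly_correlated_strong_law[OF \<open>prob_space M\<close> _ _ _ _ \<delta>])
    show "\<bar>Y0 j \<omega>\<bar> \<le> 1" for j \<omega> using Y1 by (simp add: Y0_def)
    show "\<bar>\<integral>\<omega>. Y0 j \<omega> * Y0 k \<omega> \<partial>M\<bar> \<le> 2 * real n * \<bar>\<sigma> j k\<bar>" for j k
      using Y_cov[of j k] by (cases "\<mu> j = 0"; cases "\<mu> k = 0") (simp_all add: Y0_def)
  qed simp_all
  with all show ?thesis
  proof eventually_elim
    case (elim \<omega>)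
    define R where "R p = (\<Sum>j<p. T j \<omega>)" for p
    define V where "V p = (\<Sum>j\<in>nulls \<mu> p. T j \<omega>)" for p
    have nulls: "nulls \<mu> p = {j \<in> {..<p}. \<mu> j = 0}" for p by (auto simp: nulls_def)
    have b: "(\<lambda>p. R p / real p - (\<Sum>j<p. \<xi> j) / real p) \<longlonglongrightarrow> 0"
      using elim(1) by (simp add: R_def Y_def sum_subtractf diff_divide_distrib)
    have "(\<Sum>j<p. Y0 j \<omega>) = V p - real (card (nulls \<mu> p)) * t" for p
    proof -
      have "(\<Sum>j<p. Y0 j \<omega>) = (\<Sum>j\<in>nulls \<mu> p. Y j \<omega>)"
        unfolding nulls Y0_def by (rule sum.inter_filter[symmetric]) simp
      also have "\<dots> = (\<Sum>j\<in>nulls \<mu> p. T j \<omega> - t)"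
        by (intro sum.cong) (auto simp: Y_def \<xi>_null nulls)
      finally show ?thesis by (simp add: V_def sum_subtractf)
    qed
    with elim(2) have a: "(\<lambda>p. V p / real p - real (card (nulls \<mu> p)) * t / real p) \<longlonglongrightarrow> 0"
      by (simp add: diff_divide_distrib)
    have "(\<lambda>p. (V p / real p) / (R p / real p) -
        (real (card (nulls \<mu> p)) * t / real p) / ((\<Sum>j<p. \<xi> j) / real p)) \<longlonglongrightarrow> 0"
    proof (rule ratio_difference_tendsto_0[OF a b])
      show "t / 2 > 0" using t by simp
      show "\<bar>real (card (nulls \<mu> p)) * t / real p\<bar> \<le> 1" for p
      proof -
        have "card (nulls \<mu> p) \<le> card {..<p}" by (intro card_mono) (auto simp: nulls)
        then have "real (card (nulls \<mu> p)) * t \<le> real p * 1" using t by (intro mult_mono) auto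
        then show ?thesis using t by (cases "p = 0") auto
      qed
      show "eventually (\<lambda>p. t / 2 \<le> (\<Sum>j<p. \<xi> j) / real p) sequentially"
      proof (rule eventually_mono[OF eventually_gt_at_top[of 0]])
        fix p :: nat
        assume "0 < p"
        have "(\<Sum>j<p. t / 2) \<le> (\<Sum>j<p. \<xi> j)" using \<xi>_ge by (rule sum_mono)
        then show "t / 2 \<le> (\<Sum>j<p. \<xi> j) / real p" using \<open>0 < p\<close> by (simp add: field_simps)
      qed
    qed
    moreover have "FDP n t \<mu> p (\<lambda>i j. X i j \<omega>) - real (card (nulls \<mu> p)) * t / (\<Sum>j<p. \<xi> j)
      = (V p / real p) / (R p / real p) -
        (real (card (nulls \<mu> p)) * t / real p) / ((\<Sum>j<p. \<xi> j) / real p)" for p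
    proof (cases "p = 0")
      case False
      then show ?thesis
        by (simp add: FDP_def num_rejections_def num_false_rejections_def R_def V_def T_def)
    qed (simp add: FDP_def num_rejections_def num_false_rejections_def nulls)
    ultimately show ?case unfolding \<xi>_expect by simp
  qed
qed

end
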